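(* Let $d\ge 3$ and $m\ge 0$ be integers and set $n=d+m(d-2)$. Let $\mathcal{T}$ be a $d$-angulation of the convex $n$-gon $\mathcal{P}_n$, and let $M_\mathcal{T}=(m_{i,j})_{1\le i,j\le n}$ be the associated integer matrix of numbers of $d$-paths. Then the elementary divisors of $M_\mathcal{T}$ are $d-1$ with multiplicity $m+1$, and the remaining $n-m-1$ elementary divisors are all equal to $1$. Moreover, $$\det M_\mathcal{T}=(-1)^{n-1}(d-1)^{m+1}.$$
   Context: $\mathcal{P}_n$ is a convex $n$-gon whose vertices are labelled $1,\dots,n$ in counterclockwise order; vertex labels are taken modulo $n$. A $d$-angulation of $\mathcal{P}_n$ is a dissection of $\mathcal{P}_n$ by pairwise non-crossing diagonals into $d$-gons (such a dissection exists exactly when $n=d+m(d-2)$, and then it consists of $m+1$ $d$-gons). For vertices $i,j$, a (counterclockwise) $d$-path from $i$ to $j$ is a sequence $p_{i+1},p_{i+2},\dots,p_{j-1}$ of $d$-gons of $\mathcal{T}$, indexed by the vertices met strictly between $i$ and $j$ when going counterclockwise from $i$ to $j$ (the empty sequence if $j=i+1$; the $n-1$ vertices other than $i$ if $j=i$), such that (i) $p_k$ is incident to vertex $k$ for every such $k$, and (ii) every $d$-gon of $\mathcal{T}$ appears at most $d-2$ times in the sequence. $m_{i,j}$ denotes the number of $d$-paths from $i$ to $j$, and $M_\mathcal{T}=(m_{i,j})_{1\le i,j\le n}$. Elementary divisors are those of the Smith normal form over $\mathbb{Z}$. *)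

theory Defs
  imports "Jordan_Normal_Form.Determinant" "HOL-Library.Multiset"
begin

text \<open>
  The convex \<open>n\<close>-gon is represented by its vertices \<open>0, \<dots>, n - 1\<close> in counterclockwise order;
  \<open>i\<close> stands for the vertex with label \<open>i + 1\<close>, so that rows and columns of (0-based) matrices
  correspond to vertices.  All notions below depend only on the cyclic order of the vertices.
  Diagonals are two-element vertex sets, subpolygons are given by their vertex sets.
\<close>

text \<open>
  The vertices met strictly between \<open>i\<close> and \<open>j\<close> going counterclockwise from \<open>i\<close> to \<open>j\<close>, in that
  order (for \<open>i, j < n\<close>).  For \<open>j = i\<close> these are the \<open>n - 1\<close> vertices other than \<open>i\<close>.
\<close>

definition arc :: "nat \<Rightarrow> nat \<Rightarrow> nat \<Rightarrow> nat list" where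
  "arc n i j = map (\<lambda>k. (i + 1 + k) mod n) [0..<(j + n - (i + 1)) mod n]"

definition sides :: "nat \<Rightarrow> nat set set" where
  "sides n = {{i, (i + 1) mod n} | i. i < n}"

definition diagonals :: "nat \<Rightarrow> nat set set" where
  "diagonals n = {{a, b} | a b. a < n \<and> b < n \<and> a \<noteq> b} - sides n"

definition crossing :: "nat \<Rightarrow> nat set \<Rightarrow> nat set \<Rightarrow> bool" where
  "crossing n e f \<longleftrightarrow> (\<exists>a b u v. a < n \<and> b < n \<and> a \<noteq> b \<and> e = {a, b} \<and> f = {u, v} \<and>
     u \<in> set (arc n a b) \<and> v \<in> set (arc n b a))"

definition dissection :: "nat \<Rightarrow> nat set set \<Rightarrow> bool" where
  "dissection n T \<longleftrightarrow> T \<subseteq> diagonals n \<and> (\<forall>e\<in>T. \<forall>f\<in>T. \<not> crossing n e f)"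

definition consecutive :: "nat \<Rightarrow> nat set \<Rightarrow> nat \<Rightarrow> nat \<Rightarrow> bool" where
  "consecutive n C a b \<longleftrightarrow> a \<in> C \<and> b \<in> C \<and> a \<noteq> b \<and> set (arc n a b) \<inter> C = {}"

text \<open>
  The pieces into which the polygon is cut: a subpolygon is a piece iff all of its edges are sides
  of the polygon or diagonals of the dissection, and no diagonal of the dissection is a diagonal of
  the subpolygon.  (As the dissection is non-crossing, none of its other diagonals can meet the
  interior of the subpolygon.)
\<close>

definition pieces :: "nat \<Rightarrow> nat set set \<Rightarrow> nat set set" where
  "pieces n T = {C. C \<subseteq> {..<n} \<and> card C \<ge> 3 \<and>
     (\<forall>a b. consecutive n C a b \<longrightarrow> {a, b} \<in> sides n \<union> T) \<and>
     (\<forall>a\<in>C. \<forall>b\<in>C. {a, b} \<in> T \<longrightarrow> consecutive n C a b \<or> consecutive n C b a)}"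

definition d_angulation :: "nat \<Rightarrow> nat \<Rightarrow> nat set set \<Rightarrow> bool" where
  "d_angulation n d T \<longleftrightarrow> dissection n T \<and> (\<forall>C\<in>pieces n T. card C = d)"

definition d_paths :: "nat \<Rightarrow> nat \<Rightarrow> nat set set \<Rightarrow> nat \<Rightarrow> nat \<Rightarrow> nat set list set" where
  "d_paths n d T i j = {ps. length ps = length (arc n i j) \<and> set ps \<subseteq> pieces n T \<and>
     (\<forall>k<length ps. arc n i j ! k \<in> ps ! k) \<and>
     (\<forall>p\<in>pieces n T. count_list ps p \<le> d - 2)}"

definition path_matrix :: "nat \<Rightarrow> nat \<Rightarrow> nat set set \<Rightarrow> int mat" where
  "path_matrix n d T = mat n n (\<lambda>(i, j). int (card (d_paths n d T i j)))"

text \<open>Invertibility of \<open>P\<close> and \<open>Q\<close> is over \<open>int\<close>, i.e. they are unimodular.\<close>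

definition smith_normal_form :: "int mat \<Rightarrow> int mat \<Rightarrow> bool" where
  "smith_normal_form A S \<longleftrightarrow>
     (\<exists>P Q. P \<in> carrier_mat (dim_row A) (dim_row A) \<and> Q \<in> carrier_mat (dim_col A) (dim_col A) \<and>
        invertible_mat P \<and> invertible_mat Q \<and> S = P * A * Q) \<and>
     diagonal_mat S \<and>
     (\<forall>i < min (dim_row S) (dim_col S). S $$ (i, i) \<ge> 0) \<and>
     (\<forall>i. Suc i < min (dim_row S) (dim_col S) \<longrightarrow> S $$ (i, i) dvd S $$ (Suc i, Suc i))"

text \<open>
  For a square matrix: \<open>E\<close> is the multiset of elementary divisors, i.e. of diagonal entries of the
  Smith normal form (which is unique because of the nonnegativity normalisation).
\<close>

definition elementary_divisors :: "int mat \<Rightarrow> int multiset \<Rightarrow> bool" where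
  "elementary_divisors A E \<longleftrightarrow> square_mat A \<and> (\<exists>S. smith_normal_form A S \<and> E = mset (diag_mat S))"

end

theory Submission
  imports Defs "HOL-Combinatorics.List_Permutation"
begin

text \<open>
  A subpolygon cut out by diagonals of the dissection is again \<open>d\<close>-angulated, so the matrix is built
  up by gluing on one ear (a \<open>d\<close>-gon sharing exactly one edge \<open>{x, y}\<close> with the rest) at a time,
  starting from a 2-gon without pieces.  The \<open>d - 2\<close> new vertices of an ear are incident to the ear
  only and must choose it, which exhausts its capacity when the path meets all of them; otherwise
  \<open>x\<close> or \<open>y\<close> may choose it as well.  Counting these possibilities, the old entries do not change,
  every new row (column) is the sum of the rows (columns) \<open>x\<close> and \<open>y\<close> on the old vertices, and the
  new diagonal block is \<open>J - I\<close>, where \<open>J\<close> is the all-ones matrix.  Since the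
  entries at \<open>(x, x), (x, y), (y, x), (y, y)\<close> are \<open>0, 1, 1, 0\<close>, the Schur complement is
  \<open>J - I - 2 J = - (I + J)\<close>, which is equivalent to \<open>- diag(d - 1, 1, \<dots>, 1)\<close>.
\<close>

section \<open>Unimodular equivalence\<close>

text \<open>The condition on the determinants makes the equivalence preserve the determinant itself.\<close>

definition unimod_equiv :: "'a :: idom mat \<Rightarrow> 'a mat \<Rightarrow> bool" where
  "unimod_equiv A B \<longleftrightarrow> (\<exists>n P Q. A \<in> carrier_mat n n \<and> P \<in> carrier_mat n n \<and> Q \<in> carrier_mat n n \<and>
     det P * det Q = 1 \<and> B = P * A * Q)"

lemma unimod_equivI:
  assumes "A \<in> carrier_mat n n" "P \<in> carrier_mat n n" "Q \<in> carrier_mat n n"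
    "det P * det Q = 1" "B = P * A * Q"
  shows "unimod_equiv A B"
  using assms unfolding unimod_equiv_def by blast

lemma unimod_equivE:
  assumes "unimod_equiv A B" "A \<in> carrier_mat n n"
  obtains P Q where "P \<in> carrier_mat n n" "Q \<in> carrier_mat n n" "det P * det Q = 1" "B = P * A * Q"
proof -
  obtain k P Q where *: "A \<in> carrier_mat k k" "P \<in> carrier_mat k k" "Q \<in> carrier_mat k k"
    "det P * det Q = 1" "B = P * A * Q"
    using assms(1) unfolding unimod_equiv_def by blast
  moreover have "k = n" using *(1) assms(2) by auto
  ultimately show ?thesis using that by blast
qed

lemma unimod_equiv_trans [trans]:
  assumes "unimod_equiv A B" "unimod_equiv B C"
  shows "unimod_equiv A C"
proof -
  obtain n P Q where 1: "A \<in> carrier_mat n n" "P \<in> carrier_mat n n" "Q \<in> carrier_mat n n"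
    "det P * det Q = 1" "B = P * A * Q"
    using assms(1) unfolding unimod_equiv_def by blast
  obtain n' P' Q' where 2: "B \<in> carrier_mat n' n'" "P' \<in> carrier_mat n' n'"
    "Q' \<in> carrier_mat n' n'" "det P' * det Q' = 1" "C = P' * B * Q'"
    using assms(2) unfolding unimod_equiv_def by blast
  have [simp]: "n' = n" using 1 2(1) by auto
  show ?thesis
  proof (rule unimod_equivI[of A n "P' * P" "Q * Q'"])
    have "C = P' * (P * A * Q) * Q'" using 1 2 by simp
    also have "\<dots> = (P' * P) * A * (Q * Q')"
      using 1(1-3) 2(2,3) by (simp add: assoc_mult_mat[of _ n n _ n _ n])
    finally show "C = (P' * P) * A * (Q * Q')" .
    have "det (P' * P) * det (Q * Q') = (det P * det Q) * (det P' * det Q')"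
      using 1(2,3) 2(2,3) by (simp add: det_mult)
    then show "det (P' * P) * det (Q * Q') = 1" using 1(4) 2(4) by simp
  qed (use 1 2 in auto)
qed

lemma unimod_equiv_det:
  assumes "unimod_equiv A B"
  shows "det B = det A"
proof -
  obtain n P Q where 1: "A \<in> carrier_mat n n" "P \<in> carrier_mat n n" "Q \<in> carrier_mat n n"
    "det P * det Q = 1" "B = P * A * Q"
    using assms(1) unfolding unimod_equiv_def by blast
  then have "det B = det A * (det P * det Q)"
    by (simp add: det_mult[of _ n])
  with 1 show ?thesis by simp
qed

section \<open>Block-diagonal matrices and block elimination\<close>

lemma unimod_equiv_four_block:
  assumes "unimod_equiv A A'" "unimod_equiv B B'"
    and [simp]: "A \<in> carrier_mat n n" "B \<in> carrier_mat k k"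
  shows "unimod_equiv (four_block_mat A (0\<^sub>m n k) (0\<^sub>m k n) B)
    (four_block_mat A' (0\<^sub>m n k) (0\<^sub>m k n) B')"
proof -
  obtain P Q where 1 [simp]: "P \<in> carrier_mat n n" "Q \<in> carrier_mat n n"
    and 11: "det P * det Q = 1" "A' = P * A * Q"
    using unimod_equivE[OF assms(1,3)] by blast
  obtain P' Q' where 2 [simp]: "P' \<in> carrier_mat k k" "Q' \<in> carrier_mat k k"
    and 22: "det P' * det Q' = 1" "B' = P' * B * Q'"
    using unimod_equivE[OF assms(2,4)] by blast
  show ?thesis
  proof (rule unimod_equivI)
    show "four_block_mat A (0\<^sub>m n k) (0\<^sub>m k n) B \<in> carrier_mat (n + k) (n + k)"
      "four_block_mat P (0\<^sub>m n k) (0\<^sub>m k n) P' \<in> carrier_mat (n + k) (n + k)"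
      "four_block_mat Q (0\<^sub>m n k) (0\<^sub>m k n) Q' \<in> carrier_mat (n + k) (n + k)"
      by auto
    have "det (four_block_mat P (0\<^sub>m n k) (0\<^sub>m k n) P') = det P * det P'"
      "det (four_block_mat Q (0\<^sub>m n k) (0\<^sub>m k n) Q') = det Q * det Q'"
      by (auto intro!: det_four_block_mat_upper_right_zero)
    then have "det (four_block_mat P (0\<^sub>m n k) (0\<^sub>m k n) P') *
      det (four_block_mat Q (0\<^sub>m n k) (0\<^sub>m k n) Q') = (det P * det Q) * (det P' * det Q')"
      by simp
    then show "det (four_block_mat P (0\<^sub>m n k) (0\<^sub>m k n) P') *
      det (four_block_mat Q (0\<^sub>m n k) (0\<^sub>m k n) Q') = 1"
      by (simp only: 11 22 mult_1)
    have "four_block_mat P (0\<^sub>m n k) (0\<^sub>m k n) P' * four_block_mat A (0\<^sub>m n k) (0\<^sub>m k n) B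
      = four_block_mat (P * A) (0\<^sub>m n k) (0\<^sub>m k n) (P' * B)"
      by (subst mult_four_block_mat[of _ n n _ k _ k _ _ n _ k])
        (use mult_carrier_mat[of P n n A n] mult_carrier_mat[of P' k k B k] in
          \<open>auto simp: left_mult_zero_mat[of _ k k] left_mult_zero_mat[of _ n n]
            right_mult_zero_mat[of _ k k] right_mult_zero_mat[of _ n n]\<close>)
    moreover have "\<dots> * four_block_mat Q (0\<^sub>m n k) (0\<^sub>m k n) Q' =
      four_block_mat A' (0\<^sub>m n k) (0\<^sub>m k n) B'"
      unfolding 11 22
      by (subst mult_four_block_mat[of _ n n _ k _ k _ _ n _ k])
        (use mult_carrier_mat[of P n n A n] mult_carrier_mat[of P' k k B k]
          mult_carrier_mat[of "P * A" n n Q n] mult_carrier_mat[of "P' * B" k k Q' k] in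
          \<open>auto simp: left_mult_zero_mat[of _ k k] left_mult_zero_mat[of _ n n]
            right_mult_zero_mat[of _ k k] right_mult_zero_mat[of _ n n]\<close>)
    ultimately show "four_block_mat A' (0\<^sub>m n k) (0\<^sub>m k n) B' =
      four_block_mat P (0\<^sub>m n k) (0\<^sub>m k n) P' * four_block_mat A (0\<^sub>m n k) (0\<^sub>m k n) B *
      four_block_mat Q (0\<^sub>m n k) (0\<^sub>m k n) Q'" by simp
  qed
qed

text \<open>Block elimination: subtract \<open>Y\<close> times the upper block row from the lower
  one, then the left block column times \<open>X\<close> from the right one. \<open>A\<close> need
  not be invertible because the off-diagonal blocks are already multiples of
  \<open>A\<close>.\<close>

lemma unimod_equiv_schur_complement:
  assumes [simp]: "A \<in> carrier_mat n n" "X \<in> carrier_mat n k" "Y \<in> carrier_mat k n"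
    "D \<in> carrier_mat k k"
  shows "unimod_equiv (four_block_mat A (A * X) (Y * A) D)
    (four_block_mat A (0\<^sub>m n k) (0\<^sub>m k n) (D - Y * A * X))"
proof -
  define P where "P = four_block_mat (1\<^sub>m n) (0\<^sub>m n k) (- Y) (1\<^sub>m k)"
  define Q where "Q = four_block_mat (1\<^sub>m n) (- X) (0\<^sub>m k n) (1\<^sub>m k)"
  note [simp] = uminus_carrier_iff_mat
  have [simp]: "A * X \<in> carrier_mat n k" "Y * A \<in> carrier_mat k n" "Y * A * X \<in> carrier_mat k k"
    using mult_carrier_mat[of A n n X k] mult_carrier_mat[of Y k n A n]
      mult_carrier_mat[of "Y * A" k n X k] by auto
  have [simp]: "- Y * A = - (Y * A)" "- Y * (A * X) = - (Y * A * X)" "A * - X = - (A * X)"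
    using carrier_matD[OF assms(1)] carrier_matD[OF assms(2)] carrier_matD[OF assms(3)]
    by (auto simp: assoc_mult_mat[OF assms(3,1,2)])
  show ?thesis
  proof (rule unimod_equivI)
    show "P \<in> carrier_mat (n + k) (n + k)" "Q \<in> carrier_mat (n + k) (n + k)"
      "four_block_mat A (A * X) (Y * A) D \<in> carrier_mat (n + k) (n + k)"
      by (auto simp: P_def Q_def)
    have "det P = 1" unfolding P_def
      by (subst det_four_block_mat_upper_right_zero) auto
    moreover have "det Q = 1" unfolding Q_def
      by (subst det_four_block_mat_lower_left_zero) auto
    ultimately show "det P * det Q = 1" by simp
    note c = assms \<open>A * X \<in> carrier_mat n k\<close> \<open>Y * A \<in> carrier_mat k n\<close>
      \<open>Y * A * X \<in> carrier_mat k k\<close> minus_carrier_mat[OF \<open>Y * A * X \<in> carrier_mat k k\<close>, of D]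
      uminus_carrier_mat[OF assms(2)]
    note zeros = c[THEN left_mult_zero_mat] c[THEN right_mult_zero_mat] c[THEN left_mult_one_mat]
      c[THEN right_mult_one_mat] c[THEN left_add_zero_mat] c[THEN right_add_zero_mat]
    have "- M + D = D - M" if "M \<in> carrier_mat k k" for M
      using that carrier_matD[OF assms(4)] by (intro eq_matI) auto
    from this[OF c(7)] have "P * four_block_mat A (A * X) (Y * A) D =
        four_block_mat A (A * X) (0\<^sub>m k n) (D - Y * A * X)"
      unfolding P_def
      by (subst mult_four_block_mat[of _ n n _ k _ k _ _ n _ k])
        (auto intro!: cong_four_block_mat simp: zeros)
    moreover have "\<dots> * Q = four_block_mat A (0\<^sub>m n k) (0\<^sub>m k n) (D - Y * A * X)"
      unfolding Q_def
      by (subst mult_four_block_mat[of _ n n _ k _ k _ _ n _ k])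
        (auto intro!: cong_four_block_mat simp: zeros c)
    ultimately show "four_block_mat A (0\<^sub>m n k) (0\<^sub>m k n) (D - Y * A * X) =
      P * four_block_mat A (A * X) (Y * A) D * Q" by simp
  qed
qed

section \<open>Simultaneous reordering of rows and columns\<close>

lemma unimod_equiv_permute:
  assumes A: "A \<in> carrier_mat n n" and \<pi>: "\<pi> permutes {..<n}"
  shows "unimod_equiv A (mat n n (\<lambda>(i, j). A $$ (\<pi> i, \<pi> j)))"
proof -
  define P where "P = mat n n (\<lambda>(i, j). if j = \<pi> i then 1 else 0 :: 'a)"
  have \<pi>n: "\<pi> i < n" if "i < n" for i using permutes_in_image[OF \<pi>, of i] that by auto
  have P: "P \<in> carrier_mat n n" by (simp add: P_def)
  \<comment> \<open>Left multiplication by the permutation matrix reindexes rows; right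
    multiplication by its transpose reindexes columns. Each product entry is a sum with a single
    surviving term.\<close>
  have PA: "P * B = mat n n (\<lambda>(i, j). B $$ (\<pi> i, j))" if B: "B \<in> carrier_mat n n" for B
  proof (rule eq_matI)
    fix i j assume "i < dim_row (mat n n (\<lambda>(i, j). B $$ (\<pi> i, j)))"
      "j < dim_col (mat n n (\<lambda>(i, j). B $$ (\<pi> i, j)))"
    then have ij: "i < n" "j < n" by auto
    have "(P * B) $$ (i, j) = (\<Sum>k = 0..<n. (if k = \<pi> i then B $$ (k, j) else 0))"
      using ij B by (simp add: P_def scalar_prod_def if_distrib[of "\<lambda>x. x * _"] cong: if_cong)
    then show "(P * B) $$ (i, j) = mat n n (\<lambda>(i, j). B $$ (\<pi> i, j)) $$ (i, j)"
      using ij \<pi>n by (simp add: sum.delta)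
  qed (use B in \<open>auto simp: P_def\<close>)
  have AP: "B * P\<^sup>T = mat n n (\<lambda>(i, j). B $$ (i, \<pi> j))" if B: "B \<in> carrier_mat n n" for B
  proof (rule eq_matI)
    fix i j assume "i < dim_row (mat n n (\<lambda>(i, j). B $$ (i, \<pi> j)))"
      "j < dim_col (mat n n (\<lambda>(i, j). B $$ (i, \<pi> j)))"
    then have ij: "i < n" "j < n" by auto
    have "(B * P\<^sup>T) $$ (i, j) = (\<Sum>k = 0..<n. (if k = \<pi> j then B $$ (i, k) else 0))"
      using ij B by (simp add: P_def scalar_prod_def if_distrib[of "\<lambda>x. _ * x"] cong: if_cong)
    then show "(B * P\<^sup>T) $$ (i, j) = mat n n (\<lambda>(i, j). B $$ (i, \<pi> j)) $$ (i, j)"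
      using ij \<pi>n by (simp add: sum.delta)
  qed (use B in \<open>auto simp: P_def\<close>)
  have inj: "\<pi> i = \<pi> j \<longleftrightarrow> i = j" for i j using permutes_inj[OF \<pi>] by (auto dest: injD)
  have "P * P\<^sup>T = 1\<^sub>m n"
    using P by (subst AP) (auto simp: P_def \<pi>n inj)
  \<comment> \<open>The sign of the permutation occurs twice, once for rows and once for columns,
    and so cancels.\<close>
  then have "det P * det (P\<^sup>T) = 1"
    using P det_mult[of P n "P\<^sup>T"] by simp
  moreover have "P * A * P\<^sup>T = mat n n (\<lambda>(i, j). A $$ (\<pi> i, \<pi> j))"
    using A by (subst AP, use P in simp, subst PA) (auto simp: \<pi>n)
  ultimately show ?thesis
    using A P by (intro unimod_equivI[of A n P "P\<^sup>T"]) auto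
qed

text \<open>A vertex list fixes the order of rows and columns, so that attaching an ear is appending
  to the list; by \<open>unimod_equiv_mat_on\<close> the order chosen does not matter.\<close>

definition mat_on :: "'v list \<Rightarrow> ('v \<Rightarrow> 'v \<Rightarrow> 'a) \<Rightarrow> 'a mat" where
  "mat_on vs f = mat (length vs) (length vs) (\<lambda>(i, j). f (vs ! i) (vs ! j))"

lemma mat_on_carrier [simp]: "mat_on vs f \<in> carrier_mat (length vs) (length vs)"
  by (simp add: mat_on_def)

lemma unimod_equiv_mat_on:
  fixes f :: "'v \<Rightarrow> 'v \<Rightarrow> 'a :: idom"
  assumes "mset vs = mset ws"
  shows "unimod_equiv (mat_on vs f) (mat_on ws f)"
proof -
  obtain \<pi> where \<pi>: "\<pi> permutes {..<length vs}" "permute_list \<pi> vs = ws"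
    using mset_eq_permutation[OF assms[symmetric]] by blast
  have "length ws = length vs" using assms by (metis size_mset)
  moreover have "\<pi> i < length vs" if "i < length vs" for i
    using permutes_in_image[OF \<pi>(1), of i] that by auto
  ultimately have "mat_on ws f = mat (length vs) (length vs)
      (\<lambda>(i, j). mat_on vs f $$ (\<pi> i, \<pi> j))"
    unfolding \<pi>(2)[symmetric]
    by (auto simp: mat_on_def permute_list_nth[OF \<pi>(1)])
  then show ?thesis
    using unimod_equiv_permute[OF mat_on_carrier \<pi>(1), of f] by simp
qed

section \<open>Diagonal matrices and the Smith normal form\<close>

definition diag_of :: "'a :: zero list \<Rightarrow> 'a mat" where
  "diag_of ds = mat_diag (length ds) (\<lambda>i. ds ! i)"

lemma diag_of_carrier [simp]: "diag_of ds \<in> carrier_mat (length ds) (length ds)"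
  by (simp add: diag_of_def)

lemma diag_of_append:
  "diag_of (ds @ es) = four_block_mat (diag_of ds) (0\<^sub>m (length ds) (length es))
     (0\<^sub>m (length es) (length ds)) (diag_of es)"
  by (rule eq_matI) (auto simp: diag_of_def mat_diag_def nth_append)

lemma det_diag_of: "det (diag_of ds) = prod_list ds"
proof -
  have "diag_mat (diag_of ds) = ds"
    by (rule nth_equalityI) (auto simp: diag_mat_def diag_of_def mat_diag_def)
  moreover have "upper_triangular (diag_of ds)"
    by (auto simp: diag_of_def mat_diag_def)
  ultimately show ?thesis
    using det_upper_triangular[of "diag_of ds" "length ds"] by simp
qed

lemma unimod_equiv_diag_of:
  fixes ds :: "'a :: idom list"
  assumes "mset ds = mset es"
  shows "unimod_equiv (diag_of ds) (diag_of es)"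
proof -
  obtain \<pi> where \<pi>: "\<pi> permutes {..<length ds}" "permute_list \<pi> ds = es"
    using mset_eq_permutation[OF assms[symmetric]] by blast
  have "length es = length ds" using assms by (metis size_mset)
  moreover have "\<pi> i < length ds" if "i < length ds" for i
    using permutes_in_image[OF \<pi>(1), of i] that by auto
  moreover have inj: "\<pi> i = \<pi> j \<longleftrightarrow> i = j" for i j
    using permutes_inj[OF \<pi>(1)] by (auto dest: injD)
  ultimately have "diag_of es = mat (length ds) (length ds)
      (\<lambda>(i, j). diag_of ds $$ (\<pi> i, \<pi> j))"
    unfolding \<pi>(2)[symmetric]
    by (auto simp: diag_of_def mat_diag_def permute_list_nth[OF \<pi>(1)])
  then show ?thesis
    using unimod_equiv_permute[OF diag_of_carrier \<pi>(1)] by simp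
qed

text \<open>The inverse is the adjugate scaled by the inverse \<open>u\<close> of the
  determinant.\<close>

lemma invertible_mat_if_det_unit:
  fixes A :: "'a :: comm_ring_1 mat"
  assumes A: "A \<in> carrier_mat n n" and u: "det A * u = 1"
  shows "invertible_mat A"
proof -
  define B where "B = u \<cdot>\<^sub>m adj_mat A"
  have B: "B \<in> carrier_mat n n" using adj_mat(1)[OF A] by (simp add: B_def)
  have "A * B = 1\<^sub>m n" "B * A = 1\<^sub>m n"
    using adj_mat[OF A] A u unfolding B_def
    by (simp_all add: mult_smult_distrib[of _ n n _ n] mult_smult_assoc_mat[of _ n n _ n])
      (auto intro!: eq_matI simp: mult.commute)
  then show ?thesis
    using A B unfolding invertible_mat_def inverts_mat_def by auto
qed

text \<open>A Smith normal form has nonnegative entries, while \<open>ds\<close> keeps signs for the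
  sake of the determinant. The signs are absorbed into the left transformation, which may change its
  determinant by a sign but leaves it invertible over the integers.\<close>

lemma elementary_divisors_if_unimod_equiv:
  fixes A :: "int mat"
  assumes "unimod_equiv A (diag_of ds)"
    and dvd: "\<And>i. Suc i < length ds \<Longrightarrow> ds ! i dvd ds ! Suc i"
  shows "elementary_divisors A (mset (map abs ds))"
proof -
  define N where "N = length ds"
  obtain P Q where A: "A \<in> carrier_mat N N" and P: "P \<in> carrier_mat N N"
    and Q: "Q \<in> carrier_mat N N" and PQ: "det P * det Q = 1" and eq: "diag_of ds = P * A * Q"
    using assms(1) unfolding unimod_equiv_def N_def
    by (metis carrier_matD(1) diag_of_carrier index_mult_mat(2))
  \<comment> \<open>\<open>R\<close> is the diagonal matrix of signs, with sign 1 for a zero entry;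
    multiplying by it replaces each entry by its absolute value.\<close>
  define R where "R = diag_of (map (\<lambda>x. if x < 0 then - 1 else 1 :: int) ds)"
  have R: "R \<in> carrier_mat N N"
    unfolding R_def N_def using diag_of_carrier[of "map (\<lambda>x. if x < 0 then - 1 else 1 :: int) ds"]
    by simp
  have "R * diag_of ds = diag_of (map abs ds)"
    unfolding R_def diag_of_def length_map mat_diag_diag
    by (auto simp: mat_diag_def abs_if)
  moreover have "R * diag_of ds = (R * P) * A * Q"
    unfolding eq using R P A Q by (simp add: assoc_mult_mat[of _ N N _ N _ N])
  ultimately have S: "diag_of (map abs ds) = (R * P) * A * Q" by simp
  have "prod_list (map (\<lambda>x. if x < 0 then - 1 else 1 :: int) ds) ^ 2 = 1"
    by (induction ds) (auto simp: power_mult_distrib)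
  then have "det R * det R = 1"
    unfolding R_def det_diag_of by (simp add: power2_eq_square)
  then have "(det R * det R) * (det P * det Q) = 1" using PQ by simp
  \<comment> \<open>Since \<open>det R\<close> squares to 1, \<open>det R * det Q\<close> is an
    explicit inverse of \<open>det (R * P)\<close>.\<close>
  then have "det (R * P) * (det R * det Q) = 1"
    using det_mult[OF R P] by (simp add: mult_ac)
  then have "invertible_mat (R * P)"
    using R P by (intro invertible_mat_if_det_unit) auto
  moreover have "invertible_mat Q"
    using Q PQ by (intro invertible_mat_if_det_unit[of Q N "det P"]) (auto simp: mult.commute)
  ultimately have "\<exists>P Q. P \<in> carrier_mat (dim_row A) (dim_row A) \<and>
      Q \<in> carrier_mat (dim_col A) (dim_col A) \<and> invertible_mat P \<and> invertible_mat Q \<and>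
      diag_of (map abs ds) = P * A * Q"
    using A P Q R S by (intro exI[of _ "R * P"] exI[of _ Q]) auto
  then have "smith_normal_form A (diag_of (map abs ds))"
    unfolding smith_normal_form_def using dvd
    by (auto simp: diagonal_mat_def diag_of_def mat_diag_def)
  moreover have "diag_mat (diag_of (map abs ds)) = map abs ds"
    by (rule nth_equalityI) (auto simp: diag_mat_def diag_of_def mat_diag_def)
  moreover have "square_mat A" using A by simp
  ultimately show ?thesis unfolding elementary_divisors_def by metis
qed

section \<open>Diagonal forms of the matrices arising from an ear and from the 2-gon\<close>

lemma unimod_equiv_neg_one_plus_ones:
  "unimod_equiv (mat (Suc k) (Suc k) (\<lambda>(i, j). if i = j then -2 else -1 :: int))
     (diag_of ((- int k - 2) # replicate k (-1)))"
proof -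
  define A where "A = mat (Suc k) (Suc k) (\<lambda>(i, j). if i = j then -2 else -1 :: int)"
  \<comment> \<open>\<open>P1\<close> subtracts the first row from all others, which leaves 1 in the
    first column and -1 on the diagonal below; \<open>P2\<close> then subtracts all other rows from
    the first, which collects \<open>- int k - 2\<close> in the corner; \<open>Q\<close> adds all
    other columns to the first and clears the remaining ones. All three are triangular with unit
    diagonal.\<close>
  define P1 where "P1 = mat (Suc k) (Suc k)
    (\<lambda>(i, j). if i = j then 1 else if j = 0 then -1 else 0 :: int)"
  define P2 where "P2 = mat (Suc k) (Suc k)
    (\<lambda>(i, j). if i = j then 1 else if i = 0 then -1 else 0 :: int)"
  define Q where "Q = mat (Suc k) (Suc k)
    (\<lambda>(i, j). if i = j then 1 else if j = 0 then 1 else 0 :: int)"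
  have [simp]: "A \<in> carrier_mat (Suc k) (Suc k)" "P1 \<in> carrier_mat (Suc k) (Suc k)"
    "P2 \<in> carrier_mat (Suc k) (Suc k)" "Q \<in> carrier_mat (Suc k) (Suc k)"
    by (auto simp: A_def P1_def P2_def Q_def)
  have aux: "(\<Sum>x = 0..<k. if x = b then 0 else if a = x then c else 0) =
      (\<Sum>x = 0..<k. if a = x then c else 0)" if "a \<noteq> b" for a b and c :: int
    using that by (intro sum.cong) auto
  note sums = scalar_prod_def sum.atLeast0_lessThan_Suc_shift if_distrib[of "\<lambda>x. x * _"]
    if_distrib[of "\<lambda>x. _ * x"] if_distrib[of uminus]
  have P1A: "P1 * A = mat (Suc k) (Suc k)
      (\<lambda>(i, j). if i = 0 then (if j = 0 then -2 else -1) else if j = 0 then 1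
         else if i = j then -1 else 0)" (is "_ = ?B")
  proof (rule eq_matI)
    fix i j assume "i < dim_row ?B" "j < dim_col ?B"
    then show "(P1 * A) $$ (i, j) = ?B $$ (i, j)"
      by (cases i; cases j) (auto simp: P1_def A_def sums aux simp del: sum.op_ivl_Suc cong: if_cong)
  qed (simp_all add: P1_def A_def)
  have P2P1A: "P2 * (P1 * A) = mat (Suc k) (Suc k)
      (\<lambda>(i, j). if i = 0 then (if j = 0 then - int k - 2 else 0) else if j = 0 then 1
         else if i = j then -1 else 0)" (is "_ = ?B")
    unfolding P1A
  proof (rule eq_matI)
    fix i j assume "i < dim_row ?B" "j < dim_col ?B"
    then show "(P2 * mat (Suc k) (Suc k)
      (\<lambda>(i, j). if i = 0 then (if j = 0 then -2 else -1) else if j = 0 then 1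
         else if i = j then -1 else 0)) $$ (i, j) = ?B $$ (i, j)"
      by (cases i; cases j) (auto simp: P2_def sums simp del: sum.op_ivl_Suc cong: if_cong)
  qed (simp_all add: P2_def)
  have "P2 * (P1 * A) * Q = diag_of ((- int k - 2) # replicate k (-1))" (is "_ = ?B")
    unfolding P2P1A
  proof (rule eq_matI)
    fix i j assume "i < dim_row ?B" "j < dim_col ?B"
    then show "(mat (Suc k) (Suc k)
      (\<lambda>(i, j). if i = 0 then (if j = 0 then - int k - 2 else 0) else if j = 0 then 1
         else if i = j then -1 else 0) * Q) $$ (i, j) = ?B $$ (i, j)"
      by (cases i; cases j) (auto simp: Q_def diag_of_def mat_diag_def sums simp del: sum.op_ivl_Suc cong: if_cong)
  qed (simp_all add: Q_def diag_of_def mat_diag_def)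
  then have "P2 * P1 * A * Q = diag_of ((- int k - 2) # replicate k (-1))"
    by (simp add: assoc_mult_mat[of _ "Suc k" "Suc k" _ "Suc k" _ "Suc k"])
  moreover have "det P1 = 1"
    by (subst det_lower_triangular[of "Suc k"]) (auto simp: P1_def prod_list_diag_prod)
  moreover have "det P2 = 1"
    by (subst det_upper_triangular[of _ "Suc k"]) (auto simp: P2_def prod_list_diag_prod)
  moreover have "det Q = 1"
    by (subst det_lower_triangular[of "Suc k"]) (auto simp: Q_def prod_list_diag_prod)
  ultimately show ?thesis
    unfolding A_def[symmetric]
    by (intro unimod_equivI[of A "Suc k" "P2 * P1" Q] mult_carrier_mat[of P2 "Suc k" "Suc k"])
      (auto simp: det_mult[of _ "Suc k"])
qed

lemma unimod_equiv_hyperbolic_plane: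
  "unimod_equiv (mat 2 2 (\<lambda>(i, j). if i = j then 0 else 1 :: int)) (diag_of [1, -1])"
proof -
  define A where "A = mat 2 2 (\<lambda>(i, j). if i = j then 0 else 1 :: int)"
  \<comment> \<open>\<open>U\<close> adds the second row to the first to create a pivot 1 in the
    corner; \<open>L\<close> and \<open>Q\<close> clear the entries below and to the right of
    it.\<close>
  define L where "L = mat 2 2 (\<lambda>(i, j). if i = j then 1 else if j < i then -1 else 0 :: int)"
  define U where "U = mat 2 2 (\<lambda>(i, j). if i = j then 1 else if i < j then 1 else 0 :: int)"
  define Q where "Q = mat 2 2 (\<lambda>(i, j). if i = j then 1 else if i < j then -1 else 0 :: int)"
  have [simp]: "A \<in> carrier_mat 2 2" "L \<in> carrier_mat 2 2" "U \<in> carrier_mat 2 2" "Q \<in> carrier_mat 2 2"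
    by (auto simp: A_def L_def U_def Q_def)
  have "det L = 1"
    by (subst det_lower_triangular[of 2]) (auto simp: L_def prod_list_diag_prod)
  moreover have "det U = 1" "det Q = 1"
    by (subst det_upper_triangular[of _ 2]; auto simp: U_def Q_def prod_list_diag_prod)+
  ultimately have "det (L * U) * det Q = 1" by (simp add: det_mult[of _ 2])
  moreover have "diag_of [1, -1] = L * U * A * Q" (is "_ = ?R")
  proof (rule eq_matI)
    fix i j assume "i < dim_row ?R" "j < dim_col ?R"
    then have "i < 2" "j < 2" by (auto simp: L_def Q_def)
    then show "diag_of [1, -1] $$ (i, j) = ?R $$ (i, j)"
      unfolding less_2_cases_iff
      by (elim disjE) (simp_all add: diag_of_def mat_diag_def A_def L_def U_def Q_def
          scalar_prod_def numeral_2_eq_2)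
  qed (simp_all add: diag_of_def mat_diag_def L_def Q_def)
  ultimately show ?thesis
    unfolding A_def[symmetric]
    by (intro unimod_equivI[of A 2 "L * U" Q]) (auto intro: mult_carrier_mat[of L 2 2 U])
qed

text \<open>Here \<open>g\<close> gives the old entries and \<open>f\<close> the entries after
  attaching the ear on \<open>x\<close>, \<open>y\<close> with new vertices \<open>ns\<close>. The
  border blocks are \<open>A * X\<close> and \<open>Y * A\<close>, where \<open>X\<close> and
  \<open>Y\<close> select and add the two positions of \<open>x\<close> and \<open>y\<close>;
  hypothesis \<open>two\<close> makes every entry of \<open>Y * A * X\<close> equal to 2.\<close>

lemma unimod_equiv_ear:
  fixes f g :: "'v \<Rightarrow> 'v \<Rightarrow> int"
  assumes xy: "x \<in> set vs" "y \<in> set vs"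
    and two: "g x x + g x y + g y x + g y y = 2"
    and dist: "distinct vs" "distinct ns"
    and oo: "\<And>i j. i \<in> set vs \<Longrightarrow> j \<in> set vs \<Longrightarrow> f i j = g i j"
    and "\<And>i j. i \<in> set vs \<Longrightarrow> j \<in> set ns \<Longrightarrow> f i j = g i x + g i y"
    and "\<And>i j. i \<in> set ns \<Longrightarrow> j \<in> set vs \<Longrightarrow> f i j = g x j + g y j"
    and "\<And>i j. i \<in> set ns \<Longrightarrow> j \<in> set ns \<Longrightarrow> f i j = (if i = j then 0 else 1)"
    and xney: "x \<noteq> y"
  shows "unimod_equiv (mat_on (vs @ ns) f)
    (four_block_mat (mat_on vs g) (0\<^sub>m (length vs) (length ns)) (0\<^sub>m (length ns) (length vs))
      (mat (length ns) (length ns) (\<lambda>(i, j). if i = j then -2 else -1)))"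
proof -
  let ?n = "length vs" and ?k = "length ns"
  obtain p where p: "p < ?n" "vs ! p = x" using xy by (metis in_set_conv_nth)
  obtain q where q: "q < ?n" "vs ! q = y" using xy by (metis in_set_conv_nth)
  have pq: "p \<noteq> q" using p q xney by auto
  define A where "A = mat_on vs g"
  define X where "X = mat ?n ?k (\<lambda>(i, j). if i = p then 1 else if i = q then 1 else 0 :: int)"
  define Y where "Y = mat ?k ?n (\<lambda>(i, j). if j = p then 1 else if j = q then 1 else 0 :: int)"
  define D where "D = mat ?k ?k (\<lambda>(i, j). if i = j then 0 else 1 :: int)"
  have [simp]: "A \<in> carrier_mat ?n ?n" "X \<in> carrier_mat ?n ?k" "Y \<in> carrier_mat ?k ?n"
    "D \<in> carrier_mat ?k ?k"
    by (auto simp: A_def X_def Y_def D_def)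
  \<comment> \<open>As \<open>p\<close> and \<open>q\<close> differ, the nested conditional splits
    into two single-index sums.\<close>
  have sum2: "(\<Sum>i = 0..<?n. if i = p then h i else if i = q then h' i else 0) = h p + h' q"
    for h h' :: "nat \<Rightarrow> int"
  proof -
    have "(\<Sum>i = 0..<?n. if i = p then h i else if i = q then h' i else 0) =
      (\<Sum>i = 0..<?n. (if i = p then h i else 0) + (if i = q then h' i else 0))"
      using pq by (intro sum.cong) auto
    then show ?thesis using p q by (simp add: sum.distrib)
  qed
  have AX: "A * X = mat ?n ?k (\<lambda>(i, j). g (vs ! i) x + g (vs ! i) y)"
    by (rule eq_matI)
      (auto simp: A_def X_def mat_on_def scalar_prod_def if_distrib[of "\<lambda>x. _ * x"] sum2 p q cong: if_cong)
  have YA: "Y * A = mat ?k ?n (\<lambda>(i, j). g x (vs ! j) + g y (vs ! j))"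
    by (rule eq_matI)
      (auto simp: A_def Y_def mat_on_def scalar_prod_def if_distrib[of "\<lambda>x. x * _"] sum2 p q cong: if_cong)
  have YAX: "Y * A * X = mat ?k ?k (\<lambda>(i, j). 2)"
    unfolding YA using two
    by (intro eq_matI)
      (auto simp: X_def scalar_prod_def if_distrib[of "\<lambda>x. _ * x"] sum2 p q cong: if_cong)
  have "D - Y * A * X = mat ?k ?k (\<lambda>(i, j). if i = j then -2 else -1)"
    unfolding YAX by (rule eq_matI) (auto simp: D_def)
  moreover have "four_block_mat A (A * X) (Y * A) D = mat_on (vs @ ns) f"
    unfolding AX YA
    by (rule eq_matI) (auto simp: mat_on_def A_def D_def nth_append assms nth_eq_iff_index_eq)
  ultimately show ?thesis
    using unimod_equiv_schur_complement[of A ?n X ?k Y D] by (simp add: A_def)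
qed

section \<open>Choices with bounded multiplicities\<close>

text \<open>An order-free form of a path: only the set \<open>S\<close> of vertices to be served
  matters, so vertices can be removed from it arbitrarily in recursions. Extensionality makes each
  assignment on \<open>S\<close> count once.\<close>

definition capped_choices :: "nat \<Rightarrow> 'p set set \<Rightarrow> 'p set \<Rightarrow> ('p \<Rightarrow> 'p set) set" where
  "capped_choices c PP S = {g \<in> PiE S (\<lambda>v. {p \<in> PP. v \<in> p}). \<forall>p\<in>PP. card {v \<in> S. g v = p} \<le> c}"

lemma finite_capped_choices:
  assumes "finite PP" "finite S"
  shows "finite (capped_choices c PP S)"
  unfolding capped_choices_def by (rule finite_subset[OF _ finite_PiE[OF assms(2), of "\<lambda>v. {p \<in> PP. v \<in> p}"]])
    (use assms in auto)

lemma card_capped_choices_empty [simp]: "card (capped_choices c PP {}) = 1"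
proof -
  have "capped_choices c PP {} = {\<lambda>_. undefined}" by (auto simp: capped_choices_def)
  then show ?thesis by simp
qed

lemma capped_choices_eq_empty_if_uncovered:
  assumes "v \<in> S" "\<And>p. p \<in> PP \<Longrightarrow> v \<notin> p"
  shows "capped_choices c PP S = {}"
  using assms by (fastforce simp: capped_choices_def PiE_iff)

text \<open>Pigeonhole: the fibres of a choice function cover \<open>S\<close>, and each of the
  \<open>card PP\<close> fibres has at most \<open>c\<close> elements.\<close>

lemma capped_choices_eq_empty_if_too_large:
  assumes "finite PP" "finite S" "card S > c * card PP"
  shows "capped_choices c PP S = {}"
proof (rule ccontr)
  assume "capped_choices c PP S \<noteq> {}"
  then obtain g where g: "g \<in> capped_choices c PP S" by blast
  then have "S \<subseteq> (\<Union>p\<in>PP. {v \<in> S. g v = p})"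
    by (auto simp: capped_choices_def PiE_iff)
  then have "card S \<le> card (\<Union>p\<in>PP. {v \<in> S. g v = p})"
    using assms by (intro card_mono) auto
  also have "\<dots> \<le> (\<Sum>p\<in>PP. card {v \<in> S. g v = p})"
    using assms by (intro card_UN_le) auto
  also have "\<dots> \<le> (\<Sum>p\<in>PP. c)"
    using g by (intro sum_mono) (auto simp: capped_choices_def)
  finally show False using assms by (simp add: mult.commute)
qed

text \<open>Choices are classified by their fibre \<open>U\<close> over the additional set
  \<open>q\<close>; what remains is a choice on \<open>S - U\<close> that avoids \<open>q\<close>.
  The maps \<open>ext\<close> and \<open>cut\<close> are the two directions of this
  bijection.\<close>

lemma card_capped_choices_insert:
  assumes fin: "finite PP" "finite S" and q: "q \<notin> PP"
  shows "card (capped_choices c (insert q PP) S) =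
    (\<Sum>U\<in>{U. U \<subseteq> S \<inter> q \<and> card U \<le> c}. card (capped_choices c PP (S - U)))"
proof -
  let ?I = "{U. U \<subseteq> S \<inter> q \<and> card U \<le> c}"
  define ext where "ext U g = (\<lambda>v. if v \<in> U then q else g v)" for U and g :: "'a \<Rightarrow> 'a set"
  define cut where "cut g = ({v \<in> S. g v = q}, restrict g (S - {v \<in> S. g v = q}))"
    for g :: "'a \<Rightarrow> 'a set"
  have finI: "finite ?I" using fin by simp
  have "bij_betw (\<lambda>(U, g). ext U g) (SIGMA U:?I. capped_choices c PP (S - U)) (capped_choices c (insert q PP) S)"
  proof (rule bij_betwI[where g = cut])
    show "(\<lambda>(U, g). ext U g) \<in> (SIGMA U:?I. capped_choices c PP (S - U)) \<rightarrow> capped_choices c (insert q PP) S"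
    proof (safe)
      fix U g assume U: "U \<subseteq> S \<inter> q" "card U \<le> c" and g: "g \<in> capped_choices c PP (S - U)"
      have gq: "g v \<in> PP" "v \<in> g v" "g v \<noteq> q" if "v \<in> S - U" for v
        using g that q by (auto simp: capped_choices_def PiE_iff)
      have gu: "g v = undefined" if "v \<notin> S - U" for v
        using g that by (auto simp: capped_choices_def PiE_iff extensional_def)
      have "{v \<in> S. ext U g v = q} = U"
        using U gq(3) by (auto simp: ext_def)
      moreover have "{v \<in> S. ext U g v = p} = {v \<in> S - U. g v = p}" if "p \<in> PP" for p
        using that q by (auto simp: ext_def)
      ultimately show "ext U g \<in> capped_choices c (insert q PP) S"
        using U g gq gu by (auto simp: capped_choices_def ext_def PiE_iff extensional_def)
    qed
    show "cut \<in> capped_choices c (insert q PP) S \<rightarrow> (SIGMA U:?I. capped_choices c PP (S - U))"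
    proof
      fix g assume g: "g \<in> capped_choices c (insert q PP) S"
      have "{v \<in> S - {v \<in> S. g v = q}. restrict g (S - {v \<in> S. g v = q}) v = p} =
          {v \<in> S. g v = p}" if "p \<in> PP" for p
        using that q by auto
      then have "restrict g (S - {v \<in> S. g v = q}) \<in> capped_choices c PP (S - {v \<in> S. g v = q})"
        using g by (auto simp: capped_choices_def PiE_iff)
      moreover have "{v \<in> S. g v = q} \<subseteq> S \<inter> q" "card {v \<in> S. g v = q} \<le> c"
        using g by (auto simp: capped_choices_def PiE_iff)
      ultimately show "cut g \<in> (SIGMA U:?I. capped_choices c PP (S - U))"
        by (simp add: cut_def)
    qed
  next
    fix x assume "x \<in> (SIGMA U:?I. capped_choices c PP (S - U))"
    then obtain U g where x: "x = (U, g)" and U: "U \<subseteq> S \<inter> q" and g: "g \<in> capped_choices c PP (S - U)"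
      by auto
    have "g v \<noteq> q" if "v \<in> S - U" for v
      using g that q by (auto simp: capped_choices_def PiE_iff)
    then have "{v \<in> S. ext U g v = q} = U"
      using U by (auto simp: ext_def)
    moreover have "restrict (ext U g) (S - U) = g"
      using g by (auto simp: ext_def capped_choices_def PiE_iff extensional_def restrict_def fun_eq_iff)
    ultimately show "cut (case x of (U, g) \<Rightarrow> ext U g) = x"
      by (simp add: x cut_def)
  next
    fix g assume "g \<in> capped_choices c (insert q PP) S"
    then show "(case cut g of (U, g) \<Rightarrow> ext U g) = g"
      by (auto simp: ext_def cut_def fun_eq_iff capped_choices_def PiE_iff extensional_def)
  qed
  then have "card (capped_choices c (insert q PP) S) = card (SIGMA U:?I. capped_choices c PP (S - U))"
    by (simp add: bij_betw_same_card)
  also have "\<dots> = (\<Sum>U\<in>?I. card (capped_choices c PP (S - U)))"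
    using finI fin by (intro card_SigmaI) (auto intro: finite_capped_choices)
  finally show ?thesis .
qed

text \<open>Only sets \<open>U\<close> containing all vertices private to \<open>q\<close> contribute to the sum above.\<close>

lemma card_capped_choices_insert_private:
  assumes fin: "finite PP" "finite S" and q: "q \<notin> PP"
    and N: "N \<subseteq> q" "\<And>p. p \<in> PP \<Longrightarrow> p \<inter> N = {}"
  shows "card (capped_choices c (insert q PP) S) =
    (\<Sum>B\<in>{B. B \<subseteq> S \<inter> q - N \<and> card (S \<inter> N) + card B \<le> c}. card (capped_choices c PP (S - N - B)))"
proof -
  let ?I = "{U. U \<subseteq> S \<inter> q \<and> card U \<le> c}"
  \<comment> \<open>A contributing fibre is \<open>S \<inter> N\<close> together with a set
    \<open>B\<close> of shared vertices, so the sum can run over \<open>B\<close> alone, with the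
    capacity reduced by \<open>card (S \<inter> N)\<close>.\<close>
  let ?J = "{B. B \<subseteq> S \<inter> q - N \<and> card (S \<inter> N) + card B \<le> c}"
  have un: "card (S \<inter> N \<union> B) = card (S \<inter> N) + card B" if "B \<subseteq> S \<inter> q - N" for B
    using that fin(2) by (intro card_Un_disjoint) (auto intro: finite_subset[of B S])
  have sub: "(\<lambda>B. S \<inter> N \<union> B) ` ?J \<subseteq> ?I"
  proof
    fix U assume "U \<in> (\<lambda>B. S \<inter> N \<union> B) ` ?J"
    then obtain B where "B \<in> ?J" "U = S \<inter> N \<union> B" by blast
    then show "U \<in> ?I" using un[of B] N(1) by auto
  qed
  have "(\<Sum>U\<in>?I. card (capped_choices c PP (S - U))) = (\<Sum>U\<in>(\<lambda>B. S \<inter> N \<union> B) ` ?J. card (capped_choices c PP (S - U)))"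
  proof (rule sum.mono_neutral_right)
    show "finite ?I" using fin by simp
    show "\<forall>U\<in>?I - (\<lambda>B. S \<inter> N \<union> B) ` ?J. card (capped_choices c PP (S - U)) = 0"
    proof
      fix U assume U: "U \<in> ?I - (\<lambda>B. S \<inter> N \<union> B) ` ?J"
      have "\<not> S \<inter> N \<subseteq> U"
      proof
        assume *: "S \<inter> N \<subseteq> U"
        then have eq: "U = S \<inter> N \<union> (U - N)" using U by blast
        moreover have sub: "U - N \<subseteq> S \<inter> q - N" using U by blast
        then have "card U = card (S \<inter> N) + card (U - N)"
          using un[OF sub] eq by simp
        then have "U - N \<in> ?J" using sub U by simp
        ultimately show False using U by blast
      qed
      then obtain v where "v \<in> S - U" "v \<in> N" by auto
      then have "capped_choices c PP (S - U) = {}"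
        using N(2) by (intro capped_choices_eq_empty_if_uncovered[of v]) auto
      then show "card (capped_choices c PP (S - U)) = 0" by simp
    qed
  qed (rule sub)
  also have "\<dots> = (\<Sum>B\<in>?J. card (capped_choices c PP (S - (S \<inter> N \<union> B))))"
    by (subst sum.reindex) (auto simp: inj_on_def)
  also have "\<dots> = (\<Sum>B\<in>?J. card (capped_choices c PP (S - N - B)))"
    by (intro sum.cong refl arg_cong[of _ _ "\<lambda>S. card (capped_choices c PP S)"]) auto
  finally show ?thesis using card_capped_choices_insert[OF fin q] by simp
qed

text \<open>This links \<open>d_paths\<close> to \<open>capped_choices\<close>: for distinct
  \<open>xs\<close>, reading off \<open>map g xs\<close> is a bijection from choice functions to
  lists, and multiplicities in the list are fibre sizes.\<close>

lemma card_list_assignments: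
  assumes "distinct xs"
  shows "card {ps. length ps = length xs \<and> set ps \<subseteq> PP \<and> (\<forall>k<length ps. xs ! k \<in> ps ! k) \<and>
      (\<forall>p\<in>PP. count_list ps p \<le> c)} = card (capped_choices c PP (set xs))"
    (is "card ?L = _")
proof -
  have count: "count_list (map g xs) p = card {v \<in> set xs. g v = p}" for g :: "'a \<Rightarrow> 'a set" and p
    using assms
    by (auto simp: count_list_eq_length_filter filter_map distinct_length_filter o_def
        intro!: arg_cong[of _ _ card])
  have "bij_betw (\<lambda>g. map g xs) (capped_choices c PP (set xs)) ?L"
    unfolding bij_betw_def
  proof
    show "inj_on (\<lambda>g. map g xs) (capped_choices c PP (set xs))"
    proof (rule inj_onI)
      fix g h assume "g \<in> capped_choices c PP (set xs)" "h \<in> capped_choices c PP (set xs)" "map g xs = map h xs"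
      then show "g = h"
        by (intro PiE_ext[of g "set xs" "\<lambda>v. {p \<in> PP. v \<in> p}" h]) (auto simp: capped_choices_def)
    qed
    show "(\<lambda>g. map g xs) ` capped_choices c PP (set xs) = ?L"
    proof (intro equalityI subsetI)
      fix ps assume "ps \<in> (\<lambda>g. map g xs) ` capped_choices c PP (set xs)"
      then show "ps \<in> ?L" by (auto simp: capped_choices_def PiE_iff count)
    next
      fix ps assume ps: "ps \<in> ?L"
      \<comment> \<open>The inverse map looks up the position of \<open>v\<close> in
        \<open>xs\<close>; the restriction makes it extensional.\<close>
      define g where "g = restrict (\<lambda>v. the (map_of (zip xs ps) v)) (set xs)"
      have g: "g (xs ! k) = ps ! k" if "k < length xs" for k
        using ps that assms by (simp add: g_def map_of_zip_nth)
      then have map: "map g xs = ps" using ps by (simp add: list_eq_iff_nth_eq)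
      moreover have "g \<in> capped_choices c PP (set xs)"
      proof -
        have "g v \<in> PP \<and> v \<in> g v" if v: "v \<in> set xs" for v
        proof -
          obtain k where k: "k < length xs" "v = xs ! k" using v by (auto simp: in_set_conv_nth)
          moreover have "ps ! k \<in> set ps" using k ps by (intro nth_mem) simp
          ultimately show ?thesis using g[OF k(1)] ps by auto
        qed
        moreover have "g \<in> extensional (set xs)" by (simp add: g_def)
        moreover have "card {v \<in> set xs. g v = p} \<le> c" if "p \<in> PP" for p
          using that ps by (simp add: count[symmetric] map)
        ultimately show ?thesis by (auto simp: capped_choices_def PiE_iff)
      qed
      ultimately show "ps \<in> (\<lambda>g. map g xs) ` capped_choices c PP (set xs)" by blast
    qed
  qed
  then show ?thesis by (simp add: bij_betw_same_card)
qed

section \<open>Ears of a dissection\<close>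

lemma arc_eq:
  assumes "a < n" "b < n"
  shows "arc n a b = (if a < b then [Suc a..<b] else [Suc a..<n] @ [0..<b])"
proof (cases "a < b")
  case True
  then have "b + n - (a + 1) = (b - a - 1) + n" by simp
  then have "(b + n - (a + 1)) mod n = b - a - 1"
    using assms by (simp only: mod_add_self2) simp
  then show ?thesis
    using True assms by (auto simp: arc_def intro!: nth_equalityI)
next
  case False
  then have "(b + n - (a + 1)) mod n = b + n - (a + 1)" using assms by simp
  moreover have "(a + 1 + k) mod n = a + 1 + k - n" if "k < b + n - (a + 1)" "n \<le> a + 1 + k" for k
    using that assms by (simp add: le_mod_geq)
  ultimately show ?thesis
    using False assms by (auto simp: arc_def nth_append intro!: nth_equalityI)
qed

lemma distinct_arc: "a < n \<Longrightarrow> b < n \<Longrightarrow> distinct (arc n a b)"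
  by (auto simp: arc_eq)

lemma set_arc:
  "a < n \<Longrightarrow> b < n \<Longrightarrow> set (arc n a b) = (if a < b then {a<..<b} else {a<..<n} \<union> {..<b})"
  by (auto simp: arc_eq)

lemma consecutive_less_iff:
  "a < b \<Longrightarrow> b < n \<Longrightarrow> consecutive n C a b \<longleftrightarrow> a \<in> C \<and> b \<in> C \<and> {a<..<b} \<inter> C = {}"
  by (simp add: consecutive_def set_arc)

lemma consecutive_greater_iff:
  assumes "b < a" "a < n" "C \<subseteq> {..<n}"
  shows "consecutive n C a b \<longleftrightarrow> a \<in> C \<and> b \<in> C \<and> C \<subseteq> {b..a}"
proof -
  have "c \<in> set (arc n a b) \<longleftrightarrow> c \<notin> {b..a}" if "c \<in> C" for c
    using that assms by (subst set_arc) auto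
  then have "set (arc n a b) \<inter> C = {} \<longleftrightarrow> C \<subseteq> {b..a}" by blast
  then show ?thesis using assms(1) by (auto simp: consecutive_def)
qed

lemma side_cases:
  assumes "{a, b} \<in> sides n" "a < b"
  shows "b = Suc a \<or> (a = 0 \<and> n = Suc b)"
proof -
  obtain i where i: "i < n" "{a, b} = {i, (i + 1) mod n}"
    using assms(1) by (auto simp: sides_def)
  show ?thesis
  proof (cases "i + 1 < n")
    case True
    then show ?thesis using i assms(2) by (auto simp: doubleton_eq_iff)
  next
    case False
    then have "i + 1 = n" using i(1) by simp
    then show ?thesis using i assms(2) by (auto simp: doubleton_eq_iff)
  qed
qed

text \<open>The vertices of \<open>C\<close> cut the polygon's boundary into gaps, and
  \<open>v\<close> lies in one of them. With two elements or more, the ends of a gap are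
  distinct.\<close>

lemma ex_consecutive_around:
  assumes C: "C \<subseteq> {..<n}" "card C \<ge> 2" and v: "v < n" "v \<notin> C"
  shows "\<exists>a b. consecutive n C a b \<and> v \<in> set (arc n a b)"
proof -
  have fin: "finite C" using C(1) by (rule finite_subset) simp
  show ?thesis
  proof (cases "C \<inter> {..<v} \<noteq> {} \<and> C \<inter> {v<..} \<noteq> {}")
    case True
    define a b where "a = Max (C \<inter> {..<v})" and "b = Min (C \<inter> {v<..})"
    have a: "a \<in> C \<inter> {..<v}" unfolding a_def using True fin by (intro Max_in) auto
    have b: "b \<in> C \<inter> {v<..}" unfolding b_def using True fin by (intro Min_in) auto
    have "{a<..<b} \<inter> C = {}"
    proof (rule ccontr)
      assume "{a<..<b} \<inter> C \<noteq> {}"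
      then obtain c where c: "a < c" "c < b" "c \<in> C" by auto
      have "c \<le> a" if "c < v" unfolding a_def using c that fin by (intro Max_ge) auto
      moreover have "b \<le> c" if "v < c" unfolding b_def using c that fin by (intro Min_le) auto
      ultimately show False using c v(2) by (metis linorder_neqE_nat not_less)
    qed
    then have "consecutive n C a b" using a b C(1) by (subst consecutive_less_iff) auto
    moreover have "v \<in> set (arc n a b)" using a b C(1) by (subst set_arc) auto
    ultimately show ?thesis by blast
  next
    case False
    have ne: "C \<noteq> {}" using C(2) by auto
    \<comment> \<open>Now \<open>v\<close> lies below or above all of \<open>C\<close>, so its gap
      is the one that wraps around from the largest to the smallest element.\<close>
    define a b where "a = Max C" and "b = Min C"
    have ab: "a \<in> C" "b \<in> C" using fin ne by (simp_all add: a_def b_def)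
    have sub: "C \<subseteq> {b..a}" using fin by (auto simp: a_def b_def)
    have "b \<noteq> a"
    proof
      assume "b = a"
      then have "C \<subseteq> {a}" using sub by auto
      then have "card C \<le> card {a}" by (intro card_mono) auto
      then show False using C(2) by simp
    qed
    then have ba: "b < a" using sub ab by force
    then have "consecutive n C a b" using ab sub C(1) by (subst consecutive_greater_iff) auto
    moreover have "v \<in> set (arc n a b)"
    proof (cases "C \<inter> {..<v} = {}")
      case True
      then have "\<not> b < v" using ab by auto
      then have "v < b" using ab v by (metis linorder_neqE_nat)
      then show ?thesis using ab ba C(1) v by (subst set_arc) auto
    next
      case c: False
      then have "\<not> v < a" using False ab by auto
      then have "a < v" using ab v by (metis linorder_neqE_nat)
      then show ?thesis using ab ba C(1) v by (subst set_arc) auto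
    qed
    ultimately show ?thesis by blast
  qed
qed

section \<open>Subpolygons and the ears cut off by minimal chords\<close>

locale polygon_angulation =
  fixes n d :: nat and T :: "nat set set"
  assumes d_ge: "d \<ge> 3" and angulation: "d_angulation n d T"
begin

lemma finite_pieces: "finite (pieces n T)"
  by (rule finite_subset[of _ "Pow {..<n}"]) (auto simp: pieces_def)

lemma card_piece: "C \<in> pieces n T \<Longrightarrow> card C = d"
  using angulation by (simp add: d_angulation_def)

lemma not_crossing:
  assumes "{a, b} \<in> T" "{u, v} \<in> T" "a < n" "b < n" "a \<noteq> b"
  shows "\<not> (u \<in> set (arc n a b) \<and> v \<in> set (arc n b a))"
  using angulation assms unfolding d_angulation_def dissection_def crossing_def by blast

text \<open>The bound is 2 and not 3 as in \<open>pieces\<close>: a single edge counts as a 2-gon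
  and is the base of the induction.\<close>

definition subpolygon :: "nat set \<Rightarrow> bool" where
  "subpolygon V \<longleftrightarrow> V \<subseteq> {..<n} \<and> card V \<ge> 2 \<and>
     (\<forall>a b. consecutive n V a b \<longrightarrow> {a, b} \<in> sides n \<union> T)"

definition inner_pieces :: "nat set \<Rightarrow> nat set set" where
  "inner_pieces V = {C \<in> pieces n T. C \<subseteq> V}"

lemma finite_inner_pieces [simp]: "finite (inner_pieces V)"
  using finite_pieces by (simp add: inner_pieces_def)

text \<open>Take a chord with as few vertices of \<open>V\<close> strictly between its ends as
  possible, but at least one. It will be the inner edge of an ear.\<close>

lemma ex_minimal_chord:
  assumes V: "subpolygon V" "card V \<ge> 3"
  obtains x y where "x \<in> V" "y \<in> V" "x < y" "{x, y} \<in> sides n \<union> T" "V \<inter> {x<..<y} \<noteq> {}"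
    "\<And>a b. a \<in> V \<Longrightarrow> b \<in> V \<Longrightarrow> a < b \<Longrightarrow> {a, b} \<in> sides n \<union> T \<Longrightarrow> V \<inter> {a<..<b} \<noteq> {} \<Longrightarrow>
       x \<le> a \<Longrightarrow> b \<le> y \<Longrightarrow> a = x \<and> b = y"
proof -
  have Vn: "V \<subseteq> {..<n}" using V by (simp add: subpolygon_def)
  then have fin: "finite V" by (rule finite_subset) simp
  have ne: "V \<noteq> {}" using V by auto
  define K where "K = (\<lambda>(x, y). x \<in> V \<and> y \<in> V \<and> x < y \<and> {x, y} \<in> sides n \<union> T \<and> V \<inter> {x<..<y} \<noteq> {})"
  \<comment> \<open>Some candidate exists: the largest and smallest vertex of \<open>V\<close> are
    cyclic neighbours, hence joined by an edge of \<open>V\<close>.\<close>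
  have K0: "K (Min V, Max V)"
  proof -
    have mem: "Min V \<in> V" "Max V \<in> V" using fin ne by auto
    have sub: "V \<subseteq> {Min V..Max V}" using fin by auto
    have "V \<inter> {Min V<..<Max V} \<noteq> {}"
    proof
      assume "V \<inter> {Min V<..<Max V} = {}"
      then have "V \<subseteq> {Min V, Max V}" using sub by force
      then have "card V \<le> card {Min V, Max V}" by (intro card_mono) auto
      also have "\<dots> \<le> 2" by (simp add: card_insert_if)
      finally show False using V(2) by simp
    qed
    moreover from this have lt: "Min V < Max V" by auto
    moreover have "consecutive n V (Max V) (Min V)"
      using mem sub lt Vn by (subst consecutive_greater_iff) auto
    then have "{Max V, Min V} \<in> sides n \<union> T" using V(1) unfolding subpolygon_def by blast
    ultimately show ?thesis using mem by (auto simp: K_def insert_commute)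
  qed
  obtain z where z: "K z" "\<forall>w. K w \<longrightarrow> (case z of (x, y) \<Rightarrow> card (V \<inter> {x<..<y}))
      \<le> (case w of (x, y) \<Rightarrow> card (V \<inter> {x<..<y}))"
    using ex_has_least_nat[of K, OF K0] by blast
  obtain x y where xy: "z = (x, y)" by (cases z)
  show ?thesis
  proof (rule that[of x y])
    fix a b assume ab: "a \<in> V" "b \<in> V" "a < b" "{a, b} \<in> sides n \<union> T" "V \<inter> {a<..<b} \<noteq> {}"
      "x \<le> a" "b \<le> y"
    then have "K (a, b)" by (simp add: K_def)
    then have le: "card (V \<inter> {x<..<y}) \<le> card (V \<inter> {a<..<b})" using z(2) xy by auto
    have sub: "V \<inter> {a<..<b} \<subseteq> V \<inter> {x<..<y}" using ab by auto
    \<comment> \<open>If the enclosed vertices agree, then so do the ends: an end moved inwards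
      would itself be enclosed by the outer chord only.\<close>
    have "V \<inter> {a<..<b} = V \<inter> {x<..<y}"
      using le sub fin by (intro card_seteq) auto
    then show "a = x \<and> b = y" using ab by auto
  qed (use z(1) xy in \<open>auto simp: K_def\<close>)
qed

text \<open>A piece cannot extend to both sides of a chord. If it contained both ends of the chord,
  these would have to be neighbours in the piece; if it misses an end, the edge of the piece that
  passes around this end crosses the chord.\<close>

lemma piece_subset_side_of_chord:
  assumes C: "C \<in> pieces n T" and xy: "x < y" "y < n" "{x, y} \<in> sides n \<union> T"
    and z: "z \<in> C" "x < z" "z < y"
  shows "C \<subseteq> {x..y}"
proof (rule ccontr)
  assume "\<not> C \<subseteq> {x..y}"
  then obtain w where w: "w \<in> C" "w < x \<or> y < w" by force
  have Cn: "C \<subseteq> {..<n}" and C3: "card C \<ge> 3"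
    and edge: "\<And>a b. consecutive n C a b \<Longrightarrow> {a, b} \<in> sides n \<union> T"
    and chord: "\<And>a b. a \<in> C \<Longrightarrow> b \<in> C \<Longrightarrow> {a, b} \<in> T \<Longrightarrow> consecutive n C a b \<or> consecutive n C b a"
    using C by (auto simp: pieces_def)
  have "w < n" using w Cn by auto
  \<comment> \<open>A side of the polygon has all other vertices on one side of it, but
    \<open>z\<close> and \<open>w\<close> lie on different sides.\<close>
  then have T: "{x, y} \<in> T"
    using xy side_cases[of x y n] z w by auto
  show False
  proof (cases "x \<in> C \<and> y \<in> C")
    case True
    then have "consecutive n C x y \<or> consecutive n C y x" using chord T by blast
    then show False
      using z w xy Cn by (auto simp: consecutive_less_iff consecutive_greater_iff)
  next
    case False
    \<comment> \<open>\<open>v\<close> is an end of the chord missing from \<open>C\<close>, and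
      \<open>u\<close> is the other end.\<close>
    then obtain v u where v: "v \<notin> C" "v < n" "{v, u} = {x, y}" "v \<noteq> u" "u < n"
      using xy by (metis insert_commute less_trans nat_neq_iff)
    then obtain a b where ab: "consecutive n C a b" "v \<in> set (arc n a b)"
      using ex_consecutive_around[of C n v] Cn C3 by auto
    have abC: "a \<in> C" "b \<in> C" "a \<noteq> b" "a < n" "b < n" "set (arc n a b) \<inter> C = {}"
      using ab(1) Cn by (auto simp: consecutive_def)
    have zw: "z \<notin> set (arc n a b)" "w \<notin> set (arc n a b)"
      using abC z w by auto
    \<comment> \<open>From \<open>v\<close>, one meets \<open>z\<close> or \<open>w\<close> before
      \<open>u\<close> in either direction, and the gap around \<open>v\<close> ends there at the
      latest; so \<open>u\<close> lies strictly beyond the gap.\<close>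
    have u: "u \<in> set (arc n b a)"
    proof -
      consider "v = x" "u = y" | "v = y" "u = x" using v(3) by (auto simp: doubleton_eq_iff)
      then show ?thesis
        using ab(2) zw z(2,3) w(2) abC(3-5) v(2,5) xy(1) \<open>w < n\<close>
        by cases (cases "a < b"; cases "b < a"; auto simp: set_arc)+
    qed
    \<comment> \<open>With \<open>v\<close> inside the gap and a third vertex \<open>c\<close>
      outside it, \<open>{a, b}\<close> has vertices on both sides and cannot be a side of the
      polygon.\<close>
    obtain c where c: "c \<in> C" "c \<noteq> a" "c \<noteq> b"
    proof -
      have "\<not> C \<subseteq> {a, b}"
      proof
        assume "C \<subseteq> {a, b}"
        then have "card C \<le> card {a, b}" by (intro card_mono) auto
        then show False using C3 by (simp add: card_insert_if split: if_splits)
      qed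
      then show ?thesis using that by auto
    qed
    have "{a, b} \<notin> sides n"
    proof
      assume "{a, b} \<in> sides n"
      moreover have "c \<notin> set (arc n a b)" "c < n" using abC c Cn by auto
      ultimately show False
        using abC ab(2) c side_cases[of a b n] side_cases[of b a n]
        by (cases "a < b") (auto simp: set_arc insert_commute split: if_splits)
    qed
    then have "{a, b} \<in> T" using edge[OF ab(1)] by auto
    then show False using not_crossing[of a b v u] T v ab(2) u abC by auto
  qed
qed

text \<open>The part \<open>q\<close> of \<open>V\<close> on the inner side of a minimal chord is a
  piece, hence has \<open>d\<close> vertices, and it is the only inner piece with a vertex strictly
  between \<open>x\<close> and \<open>y\<close>. Deleting those vertices makes \<open>x\<close> and
  \<open>y\<close> neighbours joined by the chord.\<close>

lemma ex_ear:
  assumes V: "subpolygon V" "card V \<ge> 3"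
  obtains x y where "x \<in> V" "y \<in> V" "x < y" "V \<inter> {x<..<y} \<noteq> {}"
    "subpolygon (V - {x<..<y})" "card (V \<inter> {x<..<y}) = d - 2"
    "inner_pieces V = insert (V \<inter> {x..y}) (inner_pieces (V - {x<..<y}))"
proof -
  have Vn: "V \<subseteq> {..<n}" using V by (simp add: subpolygon_def)
  then have fin: "finite V" by (rule finite_subset) simp
  have edge: "{a, b} \<in> sides n \<union> T" if "consecutive n V a b" for a b
    using V(1) that unfolding subpolygon_def by blast
  obtain x y where xy: "x \<in> V" "y \<in> V" "x < y" "{x, y} \<in> sides n \<union> T" "V \<inter> {x<..<y} \<noteq> {}"
    and minimal: "\<And>a b. a \<in> V \<Longrightarrow> b \<in> V \<Longrightarrow> a < b \<Longrightarrow> {a, b} \<in> sides n \<union> T \<Longrightarrow>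
      V \<inter> {a<..<b} \<noteq> {} \<Longrightarrow> x \<le> a \<Longrightarrow> b \<le> y \<Longrightarrow> a = x \<and> b = y"
    using ex_minimal_chord[OF V] by blast
  have yn: "y < n" "x < n" using xy Vn by auto
  define q where "q = V \<inter> {x..y}"
  have qn: "q \<subseteq> {..<n}" using Vn by (auto simp: q_def)
  have q_split: "q = insert x (insert y (V \<inter> {x<..<y}))" using xy by (auto simp: q_def)
  have card_q: "card q = card (V \<inter> {x<..<y}) + 2"
    unfolding q_split using fin xy by simp
  \<comment> \<open>The edges of \<open>q\<close> are edges of \<open>V\<close> together with the
    chord \<open>{x, y}\<close>. A diagonal of \<open>T\<close> inside \<open>q\<close> that
    encloses a vertex of \<open>V\<close> is the chord itself by minimality.\<close>
  have q: "q \<in> pieces n T"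
    unfolding pieces_def
  proof (intro CollectI conjI allI impI ballI)
    show "q \<subseteq> {..<n}" by (rule qn)
    have "card (V \<inter> {x<..<y}) \<noteq> 0" using xy(5) fin by auto
    then show "3 \<le> card q" unfolding card_q by linarith
    fix a b assume ab: "consecutive n q a b"
    then have mem: "a \<in> q" "b \<in> q" "a \<noteq> b" by (auto simp: consecutive_def)
    then have n: "a < n" "b < n" using qn by auto
    show "{a, b} \<in> sides n \<union> T"
    proof (cases "a < b")
      case True
      then have "consecutive n V a b"
        using ab n mem by (auto simp: consecutive_less_iff q_def)
      then show ?thesis by (rule edge)
    next
      case False
      then have "b < a" using mem by auto
      then have "q \<subseteq> {b..a}" using ab n qn by (simp add: consecutive_greater_iff)
      then have "a = y" "b = x" using mem xy unfolding q_def by force+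
      then show ?thesis using xy by (simp add: insert_commute)
    qed
  next
    have *: "consecutive n q a b \<or> consecutive n q b a"
      if ab: "a \<in> q" "b \<in> q" "{a, b} \<in> T" "a < b" for a b
    proof (cases "V \<inter> {a<..<b} = {}")
      case True
      then show ?thesis using ab qn by (subst consecutive_less_iff) (auto simp: q_def)
    next
      case False
      then have "a = x \<and> b = y" using ab by (intro minimal) (auto simp: q_def)
      then have "consecutive n q b a"
        using ab qn by (subst consecutive_greater_iff) (auto simp: q_def)
      then show ?thesis by blast
    qed
    fix a b assume ab: "a \<in> q" "b \<in> q" "{a, b} \<in> T"
    have "a \<noteq> b"
      using ab angulation
      by (auto simp: d_angulation_def dissection_def diagonals_def doubleton_eq_iff)
    then show "consecutive n q a b \<or> consecutive n q b a"
      using *[of a b] *[of b a] ab by (metis insert_commute linorder_neqE_nat)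
  qed
  \<comment> \<open>Such a piece lies within \<open>q\<close>. If it missed a vertex
    \<open>v\<close> of \<open>q\<close>, its edge around \<open>v\<close> would be a chord subject
    to minimality and so equal to \<open>{x, y}\<close>; in one orientation this leaves no room for
    \<open>z\<close>, in the other it puts \<open>v\<close> outside \<open>q\<close>.\<close>
  have unique: "C = q" if C: "C \<in> pieces n T" "C \<subseteq> V" and z: "z \<in> C" "x < z" "z < y" for C z
  proof -
    have "C \<subseteq> {x..y}" using piece_subset_side_of_chord[OF C(1) xy(3) yn(1) xy(4) z] .
    then have Cq: "C \<subseteq> q" using C by (auto simp: q_def)
    have Cn: "C \<subseteq> {..<n}" and C3: "card C \<ge> 3"
      and edgeC: "\<And>a b. consecutive n C a b \<Longrightarrow> {a, b} \<in> sides n \<union> T"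
      using C by (auto simp: pieces_def)
    show ?thesis
    proof (rule ccontr)
      assume "C \<noteq> q"
      then obtain v where v: "v \<in> q" "v \<notin> C" using Cq by auto
      then obtain a b where ab: "consecutive n C a b" "v \<in> set (arc n a b)"
        using ex_consecutive_around[of C n v] Cn C3 qn by auto
      have abC: "a \<in> C" "b \<in> C" "a \<noteq> b" "a < n" "b < n" "set (arc n a b) \<inter> C = {}"
        using ab(1) Cn by (auto simp: consecutive_def)
      have abq: "a \<in> V" "b \<in> V" "x \<le> a" "a \<le> y" "x \<le> b" "b \<le> y"
        using abC Cq by (auto simp: q_def)
      have vxy: "v \<in> V" "x \<le> v" "v \<le> y" using v by (auto simp: q_def)
      show False
      proof (cases "a < b")
        case True
        then have "v \<in> V \<inter> {a<..<b}" using ab(2) abC vxy by (simp add: set_arc)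
        then have "a = x \<and> b = y"
          using True abq edgeC[OF ab(1)] by (intro minimal) auto
        then show False using z abC True by (auto simp: set_arc)
      next
        case False
        then have ba: "b < a" using abC by auto
        then have Csub: "C \<subseteq> {b..a}" using ab(1) abC Cn by (simp add: consecutive_greater_iff)
        have "\<not> C \<subseteq> {a, b}"
        proof
          assume "C \<subseteq> {a, b}"
          then have "card C \<le> card {a, b}" by (intro card_mono) auto
          then show False using C3 by (simp add: card_insert_if split: if_splits)
        qed
        then have "V \<inter> {b<..<a} \<noteq> {}" using Csub C(2) by force
        then have "b = x \<and> a = y"
          using ba abq edgeC[OF ab(1)] by (intro minimal) (auto simp: insert_commute)
        then show False using ab(2) abC ba vxy by (auto simp: set_arc)
      qed
    qed
  qed
  define V' where "V' = V - {x<..<y}"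
  have V'n: "V' \<subseteq> {..<n}" using Vn by (auto simp: V'_def)
  have "subpolygon V'"
    unfolding subpolygon_def
  proof (intro conjI allI impI)
    show "V' \<subseteq> {..<n}" by (rule V'n)
    have "{x, y} \<subseteq> V'" using xy by (auto simp: V'_def)
    then have "card {x, y} \<le> card V'" using fin by (intro card_mono) (auto simp: V'_def)
    then show "2 \<le> card V'" using xy by simp
    fix a b assume ab: "consecutive n V' a b"
    then have mem: "a \<in> V'" "b \<in> V'" "a \<noteq> b" "set (arc n a b) \<inter> V' = {}"
      by (auto simp: consecutive_def)
    then have n: "a < n" "b < n" using V'n by auto
    show "{a, b} \<in> sides n \<union> T"
    proof (cases "set (arc n a b) \<inter> V = {}")
      case True
      then have "consecutive n V a b" using mem by (auto simp: consecutive_def V'_def)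
      then show ?thesis by (rule edge)
    next
      case False
      \<comment> \<open>A gap that becomes larger contains a deleted vertex, but its ends survive,
        so it must be the gap from \<open>x\<close> to \<open>y\<close>.\<close>
      then obtain c where c: "c \<in> set (arc n a b)" "c \<in> V" "c \<notin> V'" using mem by auto
      then have "x < c" "c < y" by (auto simp: V'_def)
      moreover have "x \<notin> set (arc n a b)" "y \<notin> set (arc n a b)"
        using mem(4) xy by (auto simp: V'_def)
      moreover have "\<not> (x < a \<and> a < y)" "\<not> (x < b \<and> b < y)" using mem by (auto simp: V'_def)
      ultimately have "a = x \<and> b = y"
        using c(1) n yn by (auto simp: set_arc split: if_splits)
      then show ?thesis using xy by simp
    qed
  qed
  moreover have "card (V \<inter> {x<..<y}) = d - 2" using card_piece[OF q] card_q by simp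
  moreover have "inner_pieces V = insert q (inner_pieces V')"
  proof (intro equalityI subsetI)
    fix C assume "C \<in> inner_pieces V"
    then show "C \<in> insert q (inner_pieces V')"
      using unique[of C] by (fastforce simp: inner_pieces_def V'_def)
  next
    fix C assume "C \<in> insert q (inner_pieces V')"
    then show "C \<in> inner_pieces V" using q by (auto simp: inner_pieces_def V'_def q_def)
  qed
  ultimately show ?thesis using that[of x y] xy unfolding V'_def q_def by blast
qed

section \<open>Path matrices of subpolygons\<close>

text \<open>Vertices keep their labels in the surrounding \<open>n\<close>-gon; intersecting the arc
  with \<open>V\<close> gives the arc of the subpolygon without relabelling.\<close>

definition paths_within :: "nat set \<Rightarrow> nat \<Rightarrow> nat \<Rightarrow> int" where
  "paths_within V i j = int (card (capped_choices (d - 2) (inner_pieces V) (set (arc n i j) \<inter> V)))"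

lemma paths_within_whole:
  assumes "i < n" "j < n"
  shows "paths_within {..<n} i j = int (card (d_paths n d T i j))"
proof -
  have "inner_pieces {..<n} = pieces n T" by (auto simp: inner_pieces_def pieces_def)
  moreover have "set (arc n i j) \<inter> {..<n} = set (arc n i j)"
    using assms by (auto simp: set_arc)
  ultimately show ?thesis
    using card_list_assignments[OF distinct_arc[OF assms], of "pieces n T" "d - 2"]
    by (simp add: paths_within_def d_paths_def)
qed

text \<open>A path from \<open>i\<close> to \<open>i\<close> would have to be longer than the capacities of the pieces allow.\<close>

lemma capped_choices_large_eq_0:
  assumes "V \<subseteq> {..<n}" "card V = 2 + card (inner_pieces V) * (d - 2)" "S \<subseteq> V" "card V \<le> Suc (card S)"
  shows "card (capped_choices (d - 2) (inner_pieces V) S) = 0"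
proof -
  have "finite S" using assms(1,3) by (meson finite_lessThan finite_subset subset_trans)
  then have "capped_choices (d - 2) (inner_pieces V) S = {}"
    using assms by (intro capped_choices_eq_empty_if_too_large) (auto simp: mult.commute)
  then show ?thesis by simp
qed

lemma paths_within_self:
  assumes V: "V \<subseteq> {..<n}" "card V = 2 + card (inner_pieces V) * (d - 2)" and i: "i \<in> V"
  shows "paths_within V i i = 0"
proof -
  have "set (arc n i i) \<inter> V = V - {i}" using V(1) i by (subst set_arc) auto
  moreover have "card V \<le> Suc (card (V - {i}))"
    unfolding card_Diff_singleton[OF i] by linarith
  ultimately show ?thesis
    using capped_choices_large_eq_0[OF V, of "V - {i}"] by (simp add: paths_within_def)
qed

text \<open>All entries follow from the recursion \<open>rec\<close>, where \<open>B\<close> is the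
  set of those among \<open>x\<close> and \<open>y\<close> that choose the ear. The hypothesis
  \<open>card'\<close> makes oversized sets contribute 0, and \<open>sym\<close> supplies the entry
  at \<open>(y, x)\<close> from the one at \<open>(x, y)\<close>.\<close>

lemma paths_within_ear:
  fixes V x y
  defines "N \<equiv> V \<inter> {x<..<y}" and "V' \<equiv> V - {x<..<y}"
  assumes V: "V \<subseteq> {..<n}" and xy: "x \<in> V" "y \<in> V" "x < y" and N: "card N = d - 2"
    and ins: "inner_pieces V = insert (V \<inter> {x..y}) (inner_pieces V')"
    and card': "card V' = 2 + card (inner_pieces V') * (d - 2)"
    and sym: "\<And>i j. i \<in> V' \<Longrightarrow> j \<in> V' \<Longrightarrow> paths_within V' i j = paths_within V' j i"
  shows paths_within_ear_old_old:
      "\<And>i j. i \<in> V' \<Longrightarrow> j \<in> V' \<Longrightarrow> paths_within V i j = paths_within V' i j"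
    and paths_within_ear_old_new: "\<And>i j. i \<in> V' \<Longrightarrow> j \<in> N \<Longrightarrow>
      paths_within V i j = paths_within V' i x + paths_within V' i y"
    and paths_within_ear_new_old: "\<And>i j. i \<in> N \<Longrightarrow> j \<in> V' \<Longrightarrow>
      paths_within V i j = paths_within V' x j + paths_within V' y j"
    and paths_within_ear_new_new: "\<And>i j. i \<in> N \<Longrightarrow> j \<in> N \<Longrightarrow>
      paths_within V i j = (if i = j then 0 else 1)"
    and paths_within_ear_base: "paths_within V' x y = 1"
    and card_inner_pieces_ear: "card (inner_pieces V) = Suc (card (inner_pieces V'))"
proof -
  let ?c = "d - 2"
  define F where "F S = card (capped_choices ?c (inner_pieces V') S)" for S
  have V'n: "V' \<subseteq> {..<n}" using V by (auto simp: V'_def)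
  have fin: "finite V" using V by (rule finite_subset) simp
  then have finN: "finite N" by (simp add: N_def)
  have c: "?c \<ge> 1" using d_ge by simp
  have xy': "x \<in> V'" "y \<in> V'" "x < n" "y < n" using xy V by (auto simp: V'_def)
  have VN: "V = V' \<union> N" "V' \<inter> N = {}" by (auto simp: V'_def N_def)
  have N0: "N \<noteq> {}" using N c by auto
  have q: "V \<inter> {x..y} \<notin> inner_pieces V'" using N0 by (auto simp: inner_pieces_def V'_def N_def)
  then show "card (inner_pieces V) = Suc (card (inner_pieces V'))" by (simp add: ins)
  have lt: "i < n" if "i \<in> V" for i using V that by auto
  have in_arc: "k \<in> set (arc n i j) \<longleftrightarrow> (if i < j then i < k \<and> k < j else i < k \<or> k < j)"
    if "i \<in> V" "j \<in> V" "k \<in> V" for i j k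
    using lt[OF that(1)] lt[OF that(2)] lt[OF that(3)] by (auto simp: set_arc)
  have rec: "paths_within V i j =
      (\<Sum>B\<in>{B. B \<subseteq> S \<inter> {x, y} \<and> card (S \<inter> N) + card B \<le> ?c}. int (F (S - N - B)))"
    if S: "S = set (arc n i j) \<inter> V" for i j S
  proof -
    have "card (capped_choices ?c (insert (V \<inter> {x..y}) (inner_pieces V')) S) =
      (\<Sum>B\<in>{B. B \<subseteq> S \<inter> (V \<inter> {x..y}) - N \<and> card (S \<inter> N) + card B \<le> ?c}. F (S - N - B))"
      unfolding F_def
      using q fin S
      by (intro card_capped_choices_insert_private) (auto simp: N_def V'_def inner_pieces_def)
    moreover have "S \<inter> (V \<inter> {x..y}) - N = S \<inter> {x, y}"
      using S xy by (auto simp: N_def)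
    ultimately show ?thesis
      using S by (simp add: paths_within_def ins)
  qed
  have F': "paths_within V' i j = int (F (set (arc n i j) \<inter> V'))" for i j
    by (simp add: paths_within_def F_def)
  have self: "paths_within V' i i = 0" if "i \<in> V'" for i
    using paths_within_self[OF V'n card' that] .
  have "set (arc n x y) \<inter> V' = {}" using xy' xy by (auto simp: set_arc V'_def)
  then show base: "paths_within V' x y = 1" by (simp add: F' F_def)
  have F0 [simp]: "F {} = 1" by (simp add: F_def)
  show "paths_within V i j = paths_within V' i j" if ij: "i \<in> V'" "j \<in> V'" for i j
  proof -
    define S where "S = set (arc n i j) \<inter> V"
    have ij': "i \<in> V" "j \<in> V" "\<not> (x < i \<and> i < y)" "\<not> (x < j \<and> j < y)"
      using ij by (auto simp: V'_def)
    \<comment> \<open>As \<open>x\<close> and \<open>y\<close> are neighbours in \<open>V'\<close>,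
      an arc between old vertices either passes over the whole ear, whose capacity \<open>N\<close>
      then exhausts, or meets neither \<open>N\<close> nor \<open>x\<close>, \<open>y\<close>.
      Either way only the empty \<open>B\<close> remains.\<close>
    have "S \<inter> {x, y} = {} \<and> S \<inter> N = {} \<or> N \<subseteq> S"
      using in_arc[OF ij'(1,2)] ij'(3,4) xy
      by (cases "i < j") (auto simp: S_def N_def)
    then have "{B. B \<subseteq> S \<inter> {x, y} \<and> card (S \<inter> N) + card B \<le> ?c} = {{}}"
    proof
      assume "N \<subseteq> S"
      then have "S \<inter> N = N" by auto
      moreover have "B = {}" if "B \<subseteq> S \<inter> {x, y}" "card B = 0" for B
        using that finite_subset[of B "{x, y}"] by auto
      ultimately show ?thesis using N by auto
    qed auto
    moreover have "S - N = set (arc n i j) \<inter> V'" by (auto simp: S_def V'_def N_def)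
    ultimately show ?thesis using rec[OF S_def] by (simp add: F')
  qed
  \<comment> \<open>An arc that misses a new vertex leaves at least one free slot in the
    ear.\<close>
  have smaller: "card (S \<inter> N) + 1 \<le> ?c" if "S \<inter> N \<subseteq> N - {j}" "j \<in> N" for S j
  proof -
    have "card (S \<inter> N) \<le> card (N - {j})" using that finN by (intro card_mono) auto
    then show ?thesis using that N c finN by (simp add: card_Diff_singleton_if)
  qed
  have none: "{B. B = {} \<and> k + card B \<le> ?c} = {{}}" if "k \<le> ?c" for k
    using that by auto
  have singles: "{B. B \<subseteq> {z} \<and> k + card B \<le> ?c} = {{}, {z}}" if "k + 1 \<le> ?c" for z :: nat and k
    using that by (auto simp: subset_singleton_iff)
  show "paths_within V i j = paths_within V' i x + paths_within V' i y"
    if ij: "i \<in> V'" "j \<in> N" for i j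
  proof -
    define S where "S = set (arc n i j) \<inter> V"
    have ij': "i \<in> V" "j \<in> V" "\<not> (x < i \<and> i < y)" "x < j" "j < y"
      using ij by (auto simp: V'_def N_def)
    have SN: "card (S \<inter> N) + 1 \<le> ?c"
      by (rule smaller[of _ j]) (use ij in_arc[OF ij'(1,2,2)] in \<open>auto simp: S_def split: if_splits\<close>)
    have "y \<notin> S" using in_arc[OF ij'(1,2) xy(2)] ij' by (auto simp: S_def split: if_splits)
    show ?thesis
    proof (cases "i = x")
      case True
      \<comment> \<open>Starting at \<open>x\<close>, the arc meets new vertices only, and the
        single path agrees with the sum 0 + 1 of the entries at \<open>(x, x)\<close> and
        \<open>(x, y)\<close>.\<close>
      then have e: "S \<inter> {x, y} = {}" "S - N = {}"
        using in_arc[OF ij'(1,2)] ij' \<open>y \<notin> S\<close> by (auto simp: S_def N_def)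
      have "paths_within V i j = 1" unfolding rec[OF S_def] e using SN by (simp add: none)
      then show ?thesis using True self[OF xy'(1)] base by simp
    next
      case False
      then have "x \<in> S" using in_arc[OF ij'(1,2) xy(1)] xy(1) ij' by (auto simp: S_def)
      then have "S \<inter> {x, y} = {x}" using \<open>y \<notin> S\<close> by auto
      \<comment> \<open>If \<open>x\<close> does not choose the ear, a path from \<open>i\<close> to
        \<open>y\<close> in \<open>V'\<close> remains; if it does, a path from \<open>i\<close> to
        \<open>x\<close>.\<close>
      moreover have "S - N = set (arc n i y) \<inter> V'"
        using in_arc[OF ij'(1,2)] in_arc[OF ij'(1) xy(2)] ij' xy
        by (auto simp: S_def N_def V'_def split: if_splits)
      moreover have "S - N - {x} = set (arc n i x) \<inter> V'"
        using in_arc[OF ij'(1,2)] in_arc[OF ij'(1) xy(1)] ij' xy False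
        by (auto simp: S_def N_def V'_def split: if_splits)
      ultimately show ?thesis using rec[OF S_def] singles[OF SN] by (simp add: F')
    qed
  qed
  show "paths_within V i j = paths_within V' x j + paths_within V' y j"
    if ij: "i \<in> N" "j \<in> V'" for i j
  proof -
    define S where "S = set (arc n i j) \<inter> V"
    have ij': "i \<in> V" "j \<in> V" "\<not> (x < j \<and> j < y)" "x < i" "i < y"
      using ij by (auto simp: V'_def N_def)
    have SN: "card (S \<inter> N) + 1 \<le> ?c"
      by (rule smaller[of _ i]) (use ij in_arc[OF ij'(1,2,1)] in \<open>auto simp: S_def split: if_splits\<close>)
    have "x \<notin> S" using in_arc[OF ij'(1,2) xy(1)] ij' by (auto simp: S_def split: if_splits)
    show ?thesis
    proof (cases "j = y")
      case True
      then have e: "S \<inter> {x, y} = {}" "S - N = {}"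
        using in_arc[OF ij'(1,2)] ij' \<open>x \<notin> S\<close> by (auto simp: S_def N_def)
      have "paths_within V i j = 1" unfolding rec[OF S_def] e using SN by (simp add: none)
      then show ?thesis using True self[OF xy'(2)] base by simp
    next
      case False
      then have "y \<in> S" using in_arc[OF ij'(1,2) xy(2)] xy(2) ij' by (auto simp: S_def)
      then have "S \<inter> {x, y} = {y}" using \<open>x \<notin> S\<close> by auto
      moreover have "S - N = set (arc n x j) \<inter> V'"
        using in_arc[OF ij'(1,2)] in_arc[OF xy(1) ij'(2)] ij' xy
        by (auto simp: S_def N_def V'_def split: if_splits)
      moreover have "S - N - {y} = set (arc n y j) \<inter> V'"
        using in_arc[OF ij'(1,2)] in_arc[OF xy(2) ij'(2)] ij' xy False
        by (auto simp: S_def N_def V'_def split: if_splits)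
      ultimately show ?thesis using rec[OF S_def] singles[OF SN] by (simp add: F')
    qed
  qed
  \<comment> \<open>The old pieces have total capacity \<open>card V' - 2\<close>, so at least two
    vertices of \<open>V'\<close> must be taken over by the ear.\<close>
  have F_large: "F V' = 0" "F (V' - {x}) = 0" "F (V' - {y}) = 0"
    unfolding F_def by (rule capped_choices_large_eq_0[OF V'n card']; auto simp: card_Diff_singleton_if)+
  have "set (arc n y x) \<inter> V' = V' - {x, y}"
    using xy' xy V'n by (auto simp: set_arc V'_def)
  then have F_one: "F (V' - {x, y}) = 1"
    using sym[OF xy'(2,1)] base by (simp add: F')
  show "paths_within V i j = (if i = j then 0 else 1)" if ij: "i \<in> N" "j \<in> N" for i j
  proof -
    define S where "S = set (arc n i j) \<inter> V"
    have ij': "i \<in> V" "j \<in> V" "x < i" "i < y" "x < j" "j < y"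
      using ij by (auto simp: N_def)
    note arc = in_arc[OF ij'(1,2)]
    show ?thesis
    proof (cases "i < j")
      case True
      then have e: "S \<inter> {x, y} = {}" "S - N = {}"
        using arc ij' by (auto simp: S_def N_def)
      have "card (S \<inter> N) \<le> ?c" using N finN by (metis card_mono inf_le2)
      then show ?thesis unfolding rec[OF S_def] e using True by (simp add: none)
    next
      case False
      \<comment> \<open>For \<open>j \<le> i\<close> the arc wraps around and meets every old
        vertex.\<close>
      then have S: "S \<inter> {x, y} = {x, y}" "S - N = V'"
        using arc ij' xy by (auto simp: S_def N_def V'_def)
      have sub_xy: "B \<subseteq> {x, y} \<longleftrightarrow> B = {} \<or> B = {x} \<or> B = {y} \<or> B = {x, y}" for B
        by blast
      show ?thesis
      proof (cases "i = j")
        case True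
        \<comment> \<open>One slot of the ear is left, so \<open>x\<close> and \<open>y\<close>
          cannot both choose it and every term vanishes.\<close>
        then have "S \<inter> N = N - {i}" using arc ij by (auto simp: S_def N_def)
        then have "card (S \<inter> N) + 1 = ?c" using N c ij finN by simp
        then have "{B. B \<subseteq> S \<inter> {x, y} \<and> card (S \<inter> N) + card B \<le> ?c} = {{}, {x}, {y}}"
          unfolding S sub_xy using xy by auto
        then show ?thesis using rec[OF S_def] True xy F_large by (simp add: S)
      next
        case neq: False
        \<comment> \<open>Two slots or more are left; only \<open>B = {x, y}\<close> contributes,
          and it contributes 1.\<close>
        have "S \<inter> N \<subseteq> N - {i, j}" using arc ij False neq by (auto simp: S_def N_def)
        then have "card (S \<inter> N) \<le> card (N - {i, j})" using finN by (intro card_mono) auto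
        also have "card (N - {i, j}) = card N - 2"
          using ij neq finN by (subst card_Diff_subset) auto
        finally have "card (S \<inter> N) + 2 \<le> ?c"
          using N card_mono[of N "{i, j}"] ij neq finN by simp
        then have "{B. B \<subseteq> S \<inter> {x, y} \<and> card (S \<inter> N) + card B \<le> ?c} = {{}, {x}, {y}, {x, y}}"
          unfolding S sub_xy using xy by auto
        then show ?thesis using rec[OF S_def] neq xy F_large F_one by (simp add: S)
      qed
    qed
  qed
qed

text \<open>Strong induction on the number of vertices by cutting off an ear. Cardinality and
  symmetry are carried along because \<open>paths_within_ear\<close> needs them for the smaller
  subpolygon. The list \<open>ds\<close> keeps its signs so that the same diagonal form yields both
  elementary divisors and determinant.\<close>

lemma subpolygon_path_matrix:
  assumes "subpolygon V"
  shows "card V = 2 + card (inner_pieces V) * (d - 2) \<and>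
    (\<forall>i\<in>V. \<forall>j\<in>V. paths_within V i j = paths_within V j i) \<and>
    (\<exists>vs ds. distinct vs \<and> set vs = V \<and>
       unimod_equiv (mat_on vs (paths_within V)) (diag_of ds) \<and>
       mset (map abs ds) = replicate_mset (card (inner_pieces V)) (int d - 1) +
         replicate_mset (card V - card (inner_pieces V)) 1 \<and>
       prod_list ds = (-1) ^ (card V - 1) * (int d - 1) ^ card (inner_pieces V))"
  using assms
proof (induction "card V" arbitrary: V rule: less_induct)
  case less
  have Vn: "V \<subseteq> {..<n}" and V2: "card V \<ge> 2" using less.prems by (auto simp: subpolygon_def)
  have fin: "finite V" using Vn by (rule finite_subset) simp
  show ?case
  proof (cases "card V = 2")
    case True
    then obtain x y where xy: "V = {x, y}" "x \<noteq> y" by (auto simp: card_2_iff)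
    have "inner_pieces V = {}"
    proof (rule ccontr)
      assume "inner_pieces V \<noteq> {}"
      then obtain C where "C \<subseteq> V" "card C \<ge> 3" by (auto simp: inner_pieces_def pieces_def)
      then show False using card_mono[OF fin, of C] True by simp
    qed
    then have r: "card (inner_pieces V) = 0" by simp
    have one: "paths_within V i j = 1" if "i \<in> V" "j \<in> V" "i \<noteq> j" for i j
    proof -
      have ij: "V = {i, j}" using that xy by auto
      moreover have "i \<notin> set (arc n i j)" "j \<notin> set (arc n i j)"
        using that Vn by (simp_all add: subset_iff set_arc)
      ultimately have "set (arc n i j) \<inter> V = {}" by simp
      then show ?thesis by (simp add: paths_within_def)
    qed
    have "card V = 2 + card (inner_pieces V) * (d - 2)" using True r by simp
    from paths_within_self[OF Vn this] have self: "paths_within V i i = 0" if "i \<in> V" for i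
      using that .
    \<comment> \<open>In a 2-gon there are no pieces; the paths between distinct vertices are empty,
      so there is exactly one.\<close>
    have "mat_on [x, y] (paths_within V) = mat 2 2 (\<lambda>(i, j). if i = j then 0 else 1)"
      using xy one[of x y] one[of y x] self[of x] self[of y]
      by (intro eq_matI) (auto simp: mat_on_def nth_Cons' less_2_cases_iff)
    then have "unimod_equiv (mat_on [x, y] (paths_within V)) (diag_of [1, -1])"
      using unimod_equiv_hyperbolic_plane by simp
    moreover have "\<forall>i\<in>V. \<forall>j\<in>V. paths_within V i j = paths_within V j i"
      using one by metis
    moreover have "mset (map abs [1, -1 :: int]) =
        replicate_mset 0 (int d - 1) + replicate_mset (2 - 0) 1"
      by (simp add: numeral_2_eq_2)
    moreover have "prod_list [1, -1] = (-1) ^ (2 - 1) * (int d - 1) ^ 0" by simp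
    moreover have "distinct [x, y]" "set [x, y] = V" using xy by simp_all
    moreover have "2 = 2 + 0 * (d - 2)" by simp
    ultimately show ?thesis unfolding True r by blast
  next
    case False
    then have "card V \<ge> 3" using V2 by simp
    from ex_ear[OF less.prems this] obtain x y where
      xy: "x \<in> V" "y \<in> V" "x < y" and ne: "V \<inter> {x<..<y} \<noteq> {}"
      and sub': "subpolygon (V - {x<..<y})" and cardN: "card (V \<inter> {x<..<y}) = d - 2"
      and ins: "inner_pieces V = insert (V \<inter> {x..y}) (inner_pieces (V - {x<..<y}))" by blast
    define V' where "V' = V - {x<..<y}"
    define N where "N = V \<inter> {x<..<y}"
    define r where "r = card (inner_pieces V')"
    have VN: "V = V' \<union> N" "V' \<inter> N = {}" by (auto simp: V'_def N_def)
    have finVN: "finite V'" "finite N" using fin by (auto simp: V'_def N_def)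
    have cV: "card V = card V' + card N" using VN finVN card_Un_disjoint[of V' N] by simp
    have xy': "x \<in> V'" "y \<in> V'" using xy by (auto simp: V'_def)
    have "card V' < card V" using cV ne finVN by (simp add: N_def card_gt_0_iff)
    from less.hyps[OF this] sub' obtain vs ds where
      card': "card V' = 2 + r * (d - 2)"
      and sym': "\<And>i j. i \<in> V' \<Longrightarrow> j \<in> V' \<Longrightarrow> paths_within V' i j = paths_within V' j i"
      and vs: "distinct vs" "set vs = V'"
      and equiv: "unimod_equiv (mat_on vs (paths_within V')) (diag_of ds)"
      and ds: "mset (map abs ds) = replicate_mset r (int d - 1) + replicate_mset (card V' - r) 1"
      and prod: "prod_list ds = (-1) ^ (card V' - 1) * (int d - 1) ^ r"
      unfolding V'_def[symmetric] r_def by blast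
    note ear = paths_within_ear[of V x y, folded V'_def N_def, OF Vn xy cardN[folded N_def]
        ins[folded V'_def] card'[unfolded r_def] sym']
    have r': "card (inner_pieces V) = Suc r" using ear(6) by (simp add: r_def)
    have self: "paths_within V' i i = 0" if "i \<in> V'" for i
      using paths_within_self[OF _ card'[unfolded r_def] that] Vn by (auto simp: V'_def)
    have sym: "paths_within V i j = paths_within V j i" if "i \<in> V" "j \<in> V" for i j
    proof -
      have "i \<in> V' \<or> i \<in> N" "j \<in> V' \<or> j \<in> N" using that VN(1) by auto
      then show ?thesis
        using sym' xy' by (elim disjE) (simp_all add: ear(1-4))
    qed
    obtain ns where ns: "distinct ns" "set ns = N" using finite_distinct_list[OF finVN(2)] by blast
    have len: "length ns = d - 2" "length vs = card V'"
      using distinct_card[OF ns(1)] distinct_card[OF vs(1)] ns vs cardN by (auto simp: N_def)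
    \<comment> \<open>Thus \<open>k\<close> is \<open>d - 3\<close>: the ear adds a block of size
      \<open>Suc k\<close> with diagonal form \<open>es\<close>, that is \<open>-(d - 1)\<close>
      once and -1 \<open>k\<close> times.\<close>
    obtain k where k: "d - 2 = Suc k" using d_ge by (cases "d - 2") auto
    have dk: "int d - 1 = int k + 2" using k by linarith
    define es where "es = (- int k - 2) # replicate k (-1 :: int)"
    have len_ds: "length ds = length vs"
    proof -
      have "length ds = r + (card V' - r)"
        using arg_cong[OF ds, of size] by simp
      moreover have "r \<le> card V'" using card' k by simp
      ultimately show ?thesis using len by simp
    qed
    have "unimod_equiv (mat_on (vs @ ns) (paths_within V))
      (four_block_mat (mat_on vs (paths_within V')) (0\<^sub>m (length vs) (length ns))
        (0\<^sub>m (length ns) (length vs))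
        (mat (length ns) (length ns) (\<lambda>(i, j). if i = j then -2 else -1)))"
    proof (rule unimod_equiv_ear)
      show "x \<in> set vs" "y \<in> set vs" using vs xy' by auto
      show "paths_within V' x x + paths_within V' x y + paths_within V' y x + paths_within V' y y = 2"
        using self xy' sym'[OF xy'(2,1)] ear(5) by simp
    qed (use vs ns xy ear(1-4) in auto)
    also have "unimod_equiv \<dots> (four_block_mat (diag_of ds) (0\<^sub>m (length vs) (length ns))
        (0\<^sub>m (length ns) (length vs)) (diag_of es))"
      using unimod_equiv_neg_one_plus_ones[of k] len(1) k
      by (intro unimod_equiv_four_block equiv) (auto simp: es_def)
    also have "\<dots> = diag_of (ds @ es)"
      using len len_ds k by (simp add: diag_of_append es_def)
    finally have "unimod_equiv (mat_on (vs @ ns) (paths_within V)) (diag_of (ds @ es))" .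
    moreover have "mset (map abs (ds @ es)) = replicate_mset (Suc r) (int d - 1) +
        replicate_mset (card V - Suc r) 1"
    proof -
      have "card V - Suc r = (card V' - r) + k"
        using cV card' k cardN by (simp add: N_def)
      moreover have "replicate_mset (a + b) z = replicate_mset a z + replicate_mset b z"
        for a b and z :: int by (induction a) auto
      moreover have "mset (map abs es) = add_mset (int d - 1) (replicate_mset k 1)"
        using dk by (simp add: es_def)
      ultimately show ?thesis using ds by simp
    qed
    moreover have "prod_list (ds @ es) = (-1) ^ (card V - 1) * (int d - 1) ^ Suc r"
    proof -
      \<comment> \<open>All \<open>Suc k\<close> entries of \<open>es\<close> are negative, one for
        each new vertex, so the sign keeps pace with the exponent.\<close>
      have "card V - 1 = (card V' - 1) + Suc k"
        using cV card' k cardN by (simp add: N_def)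
      then have "(-1 :: int) ^ (card V - 1) = (-1) ^ (card V' - 1) * (-1) ^ Suc k"
        by (simp only: power_add)
      then show ?thesis
        using prod dk by (simp add: es_def algebra_simps)
    qed
    moreover have "distinct (vs @ ns)" "set (vs @ ns) = V"
      using vs ns VN by auto
    moreover have "card V = 2 + Suc r * (d - 2)"
      using cV card' cardN by (simp add: N_def)
    ultimately show ?thesis unfolding r' using sym by blast
  qed
qed

end

section \<open>From subpolygons to the whole polygon\<close>

theorem theorem1p2:
  fixes d m n :: nat and T :: "nat set set"
  assumes "d \<ge> 3"
    and "n = d + m * (d - 2)"
    and "d_angulation n d T"
  shows "elementary_divisors (path_matrix n d T)
           (replicate_mset (m + 1) (int d - 1) + replicate_mset (n - m - 1) 1)
         \<and> det (path_matrix n d T) = (-1) ^ (n - 1) * (int d - 1) ^ (m + 1)"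
proof -
  interpret polygon_angulation n d T
    using assms by unfold_locales
  let ?V = "{..<n}" and ?f = "paths_within {..<n}"
  have n3: "n \<ge> 3" using assms by simp
  have "subpolygon ?V"
    unfolding subpolygon_def
  proof (intro conjI allI impI)
    fix a b assume ab: "consecutive n ?V a b"
    then have n: "a < n" "b < n" "a \<noteq> b" by (auto simp: consecutive_def)
    have "b = (a + 1) mod n"
    proof (cases "a < b")
      case True
      then have "{a<..<b} \<inter> ?V = {}" using ab n by (simp add: consecutive_less_iff)
      then have "\<not> Suc a < b" using n by auto
      then show ?thesis using True n by simp
    next
      case False
      then have "?V \<subseteq> {b..a}" using ab n by (simp add: consecutive_greater_iff)
      \<comment> \<open>A neighbour pair that wraps around must be \<open>n - 1\<close> and
        0.\<close>
      then have "0 \<in> {b..a}" "n - 1 \<in> {b..a}" using n by (auto simp: subset_iff)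
      then show ?thesis using n by (cases "a + 1 = n") auto
    qed
    then show "{a, b} \<in> sides n \<union> T" using n by (auto simp: sides_def)
  qed (use n3 in auto)
  from subpolygon_path_matrix[OF this] obtain vs ds where
    card: "n = 2 + card (inner_pieces ?V) * (d - 2)"
    and vs: "distinct vs" "set vs = ?V"
    and equiv: "unimod_equiv (mat_on vs ?f) (diag_of ds)"
    and ds: "mset (map abs ds) = replicate_mset (card (inner_pieces ?V)) (int d - 1) +
      replicate_mset (n - card (inner_pieces ?V)) 1"
    and prod: "prod_list ds = (-1) ^ (n - 1) * (int d - 1) ^ card (inner_pieces ?V)"
    by auto
  \<comment> \<open>Writing \<open>d\<close> as \<open>2 + (d - 2)\<close> gives
    \<open>n = 2 + (m + 1) * (d - 2)\<close>; cancelling the positive factor \<open>d - 2\<close>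
    yields the number of pieces.\<close>
  have "card (inner_pieces ?V) * (d - 2) + 2 = (m + 1) * (d - 2) + 2"
    using card[symmetric] assms(1,2) by (simp add: add_ac)
  then have "card (inner_pieces ?V) * (d - 2) = (m + 1) * (d - 2)" by simp
  then have r: "card (inner_pieces ?V) = m + 1"
    using assms(1) by (subst (asm) mult_cancel2) auto
  have "mset [0..<n] = mset vs"
    using vs by (metis atLeast0LessThan distinct_upt set_eq_iff_mset_eq_distinct set_upt)
  then have "unimod_equiv (mat_on [0..<n] ?f) (mat_on vs ?f)"
    by (rule unimod_equiv_mat_on)
  also have "mat_on [0..<n] ?f = path_matrix n d T"
    by (rule eq_matI) (auto simp: mat_on_def path_matrix_def paths_within_whole)
  also note equiv
  finally have M: "unimod_equiv (path_matrix n d T) (diag_of ds)" .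
  \<comment> \<open>The ears put the entries in no divisibility order. Entries of absolute value 1
    are moved to the front; all others have absolute value \<open>d - 1\<close> and divide each
    other.\<close>
  define es where "es = filter (\<lambda>x. abs x = 1) ds @ filter (\<lambda>x. abs x \<noteq> 1) ds"
  have es: "mset es = mset ds" by (simp add: es_def)
  have "set_mset (mset (map abs ds)) \<subseteq> {int d - 1, 1}"
    unfolding ds by auto
  then have abs_ds: "abs z = int d - 1 \<or> abs z = 1" if "z \<in> set ds" for z
    using that by auto
  have dvd: "es ! i dvd es ! Suc i" if i: "Suc i < length es" for i
  proof (cases "i < length (filter (\<lambda>x. abs x = 1) ds)")
    case True
    then have "es ! i \<in> set (filter (\<lambda>x. abs x = 1) ds)"
      by (simp only: es_def nth_append if_True nth_mem)
    then have "abs (es ! i) = 1" by simp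
    then have "abs (es ! i) dvd es ! Suc i" by simp
    then show ?thesis by simp
  next
    case False
    have "abs (es ! j) = int d - 1" if "i \<le> j" "j < length es" for j
    proof -
      have "es ! j \<in> set (filter (\<lambda>x. abs x \<noteq> 1) ds)"
        using False that by (auto simp: es_def nth_append simp del: set_filter intro!: nth_mem)
      then show ?thesis using abs_ds by auto
    qed
    from this[of i] this[of "Suc i"] i have "abs (es ! i) = abs (es ! Suc i)" by simp
    then show ?thesis by (metis abs_dvd_iff dvd_abs_iff dvd_refl)
  qed
  have "elementary_divisors (path_matrix n d T) (mset (map abs es))"
    using unimod_equiv_trans[OF M unimod_equiv_diag_of[OF es[symmetric]]] dvd
    by (rule elementary_divisors_if_unimod_equiv)
  moreover have "mset (map abs es) = mset (map abs ds)" using es by simp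
  ultimately have "elementary_divisors (path_matrix n d T)
      (replicate_mset (m + 1) (int d - 1) + replicate_mset (n - m - 1) 1)"
    using ds r by simp
  moreover have "det (path_matrix n d T) = (-1) ^ (n - 1) * (int d - 1) ^ (m + 1)"
    using unimod_equiv_det[OF M] prod r by (simp add: det_diag_of)
  ultimately show ?thesis by blast
qed

end
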